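(* Under the hypotheses and notation of the Darboux theorem below (solution $q$ of the $(2j-1)$-th $\mathcal{G}_{m,n}$-flow with frame $F$, $\alpha\neq0$, $\pi$ an $O(m+n+1,m+n)$-projection, $\tilde\pi(x,t)$ the $O(m+n+1,m+n)$-projection onto $F(x,t,\alpha)^{-1}(\mathrm{Im}\,\pi)$, assumed nondegenerate), $\tilde\pi$ satisfies $$\tilde\pi_x=\big(J(\alpha)+q+2\alpha[e_{2m+1,2m+2n+1},\tilde\pi]\big)\tilde\pi^\perp-\tilde\pi^\perp\big(J(\alpha)+q\big),$$ $$\tilde\pi_t=\Big(S\big(q+2\alpha[e_{2m+1,2m+2n+1},\tilde\pi],\lambda\big)^{2j-1}\Big)_+\Big|_{\lambda=\alpha}\tilde\pi^\perp-\tilde\pi^\perp\Big(S(q,\lambda)^{2j-1}\Big)_+\Big|_{\lambda=\alpha},$$ where $\tilde\pi^\perp=I-\tilde\pi$.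
   Context: Darboux theorem being referred to: if $q$ solves the flow with frame $F$, and the form is nondegenerate on $\tilde V=F(x,t,\alpha)^{-1}(\mathrm{Im}\,\pi)$ with projection $\tilde\pi$, then $\tilde q=q+2\alpha[e_{2m+1,N},\tilde\pi]$ solves the flow with frame $k_{\alpha,\pi}Fk_{\alpha,\tilde\pi}^{-1}$. Setup: $N=2m+2n+1$; $C_{m,n}=\mathrm{diag}(\sum_{i=1}^{2m}e_{i,2m+1-i},\sum_{i=1}^{2n+1}(-1)^{n+i-1}e_{i,2n+2-i})$; $\sigma(Y)=(C_{m,n}Y^tC_{m,n}^{-1})^{-1}$, $\sigma_*(y)=-C_{m,n}y^tC_{m,n}^{-1}$; $\mathcal{G}_{m,n}$: formal series $\sum_{i\le i_0}\xi_i\lambda^i$ in $sl(N,\mathbb{C})$ with $\sigma_*(\xi(-\lambda))=\xi(\lambda)$; $(G_{m,n})_-$: series $I+\sum_{i<0}g_i\lambda^i$ with $\sigma(g(-\lambda))=g(\lambda)$; $(\cdot)_+$ = nonnegative-power part. $b=\sum_{i=1}^{2n}e_{i+1,i}$, $J_0(\lambda)=\lambda e_{1,2n+1}+b$, $J=\mathrm{diag}(0_{2m},J_0)$; $Y_{m,n}=\{([J,g])_+:g\in(\mathcal G_{m,n})_-\}$; $S(q,\lambda)$ the unique series with $S_x+[J+q,S]=0$, $S=gJg^{-1}$ ($g$ in $(G_{m,n})_-$), $S^k=\sum_iS_{k,i}\lambda^i$; flow: $q_t=S_{2j-1,0}(q)_x+[\mathrm{diag}(0,b)+q,S_{2j-1,0}(q)]$;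 frame: $F\in SL(N)$ with $F^{-1}F_x=J+q$, $F^{-1}F_t=(S^{2j-1}(q,\lambda))_+$, $\sigma(F(x,t,-\lambda))=F(x,t,\lambda)$. Form $\langle X,Y\rangle=X^tC_{m,n}Y$; $O(m+n+1,m+n)$-projection: $\pi^2=\pi=\pi^\sharp$; $k_{\alpha,\pi}=I+\frac{2\alpha}{\lambda-\alpha}(I-\pi)$. *)

theory Defs
  imports Complex_Main "Jordan_Normal_Form.Determinant"
begin

text \<open>Conventions: matrices are N x N complex matrices (Jordan_Normal_Form, 0-based indices),
  N = 2m+2n+1.  The paper's e_{i,j} (1-based) is the unit matrix at 0-based (i-1,j-1).
  Formal Laurent series in lambda with matrix coefficients are functions int => complex mat
  (coefficient of lambda^k), bounded above.\<close>

definition dimN :: "nat \<Rightarrow> nat \<Rightarrow> nat" where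
  "dimN m n = 2*m + 2*n + 1"

definition Cmat :: "nat \<Rightarrow> nat \<Rightarrow> complex mat" where
  "Cmat m n = mat (dimN m n) (dimN m n) (\<lambda>(r,c).
      if r < 2*m \<and> c < 2*m \<and> r + c + 1 = 2*m then 1
      else if 2*m \<le> r \<and> 2*m \<le> c \<and> (r - 2*m) + (c - 2*m) = 2*n then (-1) ^ (n + (r - 2*m))
      else 0)"

definition Emat :: "nat \<Rightarrow> nat \<Rightarrow> complex mat" where
  "Emat m n = mat (dimN m n) (dimN m n) (\<lambda>(r,c). if r = 2*m \<and> c = dimN m n - 1 then 1 else 0)"

definition Bmat :: "nat \<Rightarrow> nat \<Rightarrow> complex mat" where
  "Bmat m n = mat (dimN m n) (dimN m n) (\<lambda>(r,c). if 2*m \<le> c \<and> r = c + 1 then 1 else 0)"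

definition Jat :: "nat \<Rightarrow> nat \<Rightarrow> complex \<Rightarrow> complex mat" where
  "Jat m n l = l \<cdot>\<^sub>m Emat m n + Bmat m n"

type_synonym mser = "int \<Rightarrow> complex mat"

definition ser_bdd :: "nat \<Rightarrow> mser \<Rightarrow> bool" where
  "ser_bdd N S \<longleftrightarrow> (\<exists>i0. \<forall>i>i0. S i = 0\<^sub>m N N)"

definition ser_mult :: "nat \<Rightarrow> mser \<Rightarrow> mser \<Rightarrow> mser" where
  "ser_mult N A B k = mat N N (\<lambda>(r,c).
     \<Sum>i\<in>{i. A i \<noteq> 0\<^sub>m N N \<and> B (k - i) \<noteq> 0\<^sub>m N N}. (A i * B (k - i)) $$ (r,c))"

definition ser_one :: "nat \<Rightarrow> mser" where
  "ser_one N k = (if k = 0 then 1\<^sub>m N else 0\<^sub>m N N)"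

fun ser_pow :: "nat \<Rightarrow> mser \<Rightarrow> nat \<Rightarrow> mser" where
  "ser_pow N S 0 = ser_one N"
| "ser_pow N S (Suc k) = ser_mult N (ser_pow N S k) S"

definition ser_comm :: "nat \<Rightarrow> mser \<Rightarrow> mser \<Rightarrow> mser" where
  "ser_comm N A B k = ser_mult N A B k - ser_mult N B A k"

definition ser_plus :: "nat \<Rightarrow> mser \<Rightarrow> mser" where
  "ser_plus N S k = (if 0 \<le> k then S k else 0\<^sub>m N N)"

text \<open>(S)_+ evaluated at lambda = l (a polynomial for series bounded above)\<close>
definition ser_plus_eval :: "nat \<Rightarrow> mser \<Rightarrow> complex \<Rightarrow> complex mat" where
  "ser_plus_eval N S l = mat N N (\<lambda>(r,c).
     \<Sum>i\<in>{i. 0 \<le> i \<and> S i \<noteq> 0\<^sub>m N N}. l ^ (nat i) * S i $$ (r,c))"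

definition ser_reflect :: "mser \<Rightarrow> mser" where
  "ser_reflect S k = (if even k then 1 else -1) \<cdot>\<^sub>m S k"

definition Jser :: "nat \<Rightarrow> nat \<Rightarrow> mser" where
  "Jser m n k = (if k = 1 then Emat m n else if k = 0 then Bmat m n else 0\<^sub>m (dimN m n) (dimN m n))"

definition JQser :: "nat \<Rightarrow> nat \<Rightarrow> complex mat \<Rightarrow> mser" where
  "JQser m n Q k = (if k = 1 then Emat m n else if k = 0 then Bmat m n + Q else 0\<^sub>m (dimN m n) (dimN m n))"

text \<open>(G_{m,n})_- : g = I + sum_{i<0} g_i lambda^i with sigma(g(-lambda)) = g(lambda),
  where sigma(Y) = (C Y^t C^{-1})^{-1}; sigma(Y) = X is written out as X C Y^t = C.\<close>
definition G_minus :: "nat \<Rightarrow> nat \<Rightarrow> mser \<Rightarrow> bool" where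
  "G_minus m n g \<longleftrightarrow>
     (\<forall>k. g k \<in> carrier_mat (dimN m n) (dimN m n)) \<and>
     g 0 = 1\<^sub>m (dimN m n) \<and> (\<forall>k>0. g k = 0\<^sub>m (dimN m n) (dimN m n)) \<and>
     ser_mult (dimN m n) g (\<lambda>k. Cmat m n * (ser_reflect g k)\<^sup>T) = (\<lambda>k. ser_one (dimN m n) k * Cmat m n)"

text \<open>(\<G>_{m,n})_- : xi = sum_{i<0} xi_i lambda^i, xi_i in sl(N,C), sigma_*(xi(-lambda)) = xi(lambda),
  where sigma_*(y) = -C y^t C^{-1}; written out as xi_k C = - C (xi(-lambda))_k^t.\<close>
definition calG_minus :: "nat \<Rightarrow> nat \<Rightarrow> mser \<Rightarrow> bool" where
  "calG_minus m n xi \<longleftrightarrow>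
     (\<forall>k. xi k \<in> carrier_mat (dimN m n) (dimN m n) \<and> (\<Sum>r<dimN m n. xi k $$ (r,r)) = 0) \<and>
     (\<forall>k\<ge>0. xi k = 0\<^sub>m (dimN m n) (dimN m n)) \<and>
     (\<forall>k. xi k * Cmat m n = - (Cmat m n * (ser_reflect xi k)\<^sup>T))"

text \<open>Y_{m,n} = { ([J,g])_+ : g in (\<G>_{m,n})_- }  (these are lambda-independent)\<close>
definition Ymn :: "nat \<Rightarrow> nat \<Rightarrow> complex mat set" where
  "Ymn m n = {M. \<exists>g. calG_minus m n g \<and>
      ser_plus (dimN m n) (ser_comm (dimN m n) (Jser m n) g) =
        (\<lambda>k. if k = 0 then M else 0\<^sub>m (dimN m n) (dimN m n))}"

definition mat_deriv :: "(real \<Rightarrow> complex mat) \<Rightarrow> complex mat \<Rightarrow> real \<Rightarrow> bool" where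
  "mat_deriv f D x \<longleftrightarrow> (\<forall>r<dim_row D. \<forall>c<dim_col D.
      ((\<lambda>s. f s $$ (r,c)) has_vector_derivative (D $$ (r,c))) (at x))"

text \<open>S is the series S(q,lambda): S = g J g^{-1} with g in (G_{m,n})_- (written as S g = g J),
  and S_x + [J+q, S] = 0 (coefficientwise), at every (x,t).\<close>
definition is_S :: "nat \<Rightarrow> nat \<Rightarrow> (real \<Rightarrow> real \<Rightarrow> complex mat) \<Rightarrow> (real \<Rightarrow> real \<Rightarrow> mser) \<Rightarrow> bool" where
  "is_S m n q S \<longleftrightarrow> (\<forall>x t.
     ser_bdd (dimN m n) (S x t) \<and>
     (\<forall>k. S x t k \<in> carrier_mat (dimN m n) (dimN m n)) \<and>
     (\<exists>g. G_minus m n g \<and> ser_mult (dimN m n) (S x t) g = ser_mult (dimN m n) g (Jser m n)) \<and>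
     (\<forall>k. mat_deriv (\<lambda>s. S s t k)
            (- ser_comm (dimN m n) (JQser m n (q x t)) (S x t) k) x))"

definition flow_sol :: "nat \<Rightarrow> nat \<Rightarrow> nat \<Rightarrow> (real \<Rightarrow> real \<Rightarrow> complex mat) \<Rightarrow> (real \<Rightarrow> real \<Rightarrow> mser) \<Rightarrow> bool" where
  "flow_sol m n j q S \<longleftrightarrow> (\<forall>x t.
     q x t \<in> carrier_mat (dimN m n) (dimN m n) \<and> q x t \<in> Ymn m n \<and>
     (\<exists>D. mat_deriv (\<lambda>s. ser_pow (dimN m n) (S s t) (2*j-1) 0) D x \<and>
          mat_deriv (\<lambda>s. q x s)
            (D + ((Bmat m n + q x t) * ser_pow (dimN m n) (S x t) (2*j-1) 0
                  - ser_pow (dimN m n) (S x t) (2*j-1) 0 * (Bmat m n + q x t))) t))"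

text \<open>F is a frame: F in SL(N), F^{-1}F_x = J + q, F^{-1}F_t = (S^{2j-1})_+,
  sigma(F(x,t,-lambda)) = F(x,t,lambda) (written out as F(l) C F(-l)^t = C).\<close>
definition is_frame :: "nat \<Rightarrow> nat \<Rightarrow> nat \<Rightarrow> (real \<Rightarrow> real \<Rightarrow> complex mat) \<Rightarrow> (real \<Rightarrow> real \<Rightarrow> mser)
     \<Rightarrow> (real \<Rightarrow> real \<Rightarrow> complex \<Rightarrow> complex mat) \<Rightarrow> bool" where
  "is_frame m n j q S F \<longleftrightarrow> (\<forall>x t l.
     F x t l \<in> carrier_mat (dimN m n) (dimN m n) \<and> det (F x t l) = 1 \<and>
     mat_deriv (\<lambda>s. F s t l) (F x t l * (Jat m n l + q x t)) x \<and>
     mat_deriv (\<lambda>s. F x s l) (F x t l * ser_plus_eval (dimN m n) (ser_pow (dimN m n) (S x t) (2*j-1)) l) t \<and>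
     F x t l * Cmat m n * (F x t (-l))\<^sup>T = Cmat m n)"

text \<open>O(m+n+1,m+n)-projection: pi^2 = pi = pi^sharp, pi^sharp = C^{-1} pi^t C (adjoint for X^t C Y)\<close>
definition Oproj :: "nat \<Rightarrow> nat \<Rightarrow> complex mat \<Rightarrow> bool" where
  "Oproj m n P \<longleftrightarrow> P \<in> carrier_mat (dimN m n) (dimN m n) \<and> P * P = P \<and> Cmat m n * P = P\<^sup>T * Cmat m n"

definition mat_image :: "nat \<Rightarrow> complex mat \<Rightarrow> complex vec set" where
  "mat_image N P = {P *\<^sub>v v | v. v \<in> carrier_vec N}"

text \<open>F^{-1}(Im pi) written as a preimage (F invertible)\<close>
definition preimage_space :: "nat \<Rightarrow> complex mat \<Rightarrow> complex vec set \<Rightarrow> complex vec set" where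
  "preimage_space N F V = {v \<in> carrier_vec N. F *\<^sub>v v \<in> V}"

definition form_nondeg :: "nat \<Rightarrow> nat \<Rightarrow> complex vec set \<Rightarrow> bool" where
  "form_nondeg m n V \<longleftrightarrow> (\<forall>v\<in>V. (\<forall>w\<in>V. v \<bullet> (Cmat m n *\<^sub>v w) = 0) \<longrightarrow> v = 0\<^sub>v (dimN m n))"

definition mcomm :: "complex mat \<Rightarrow> complex mat \<Rightarrow> complex mat" where
  "mcomm A B = A * B - B * A"

end

theory Submission
  imports Defs "HOL-Computational_Algebra.Formal_Laurent_Series"
begin

text \<open>
  With \<open>F = F(\<alpha>)\<close> and \<open>G = F(-\<alpha>)\<close>, the reality condition on the frame identifies the kernel of the
  moving projection \<open>p\<close> with \<open>G\<^sup>-\<^sup>1 (ker \<pi>)\<close>, while its image is \<open>F\<^sup>-\<^sup>1 (Im \<pi>)\<close>. Hence \<open>p\<close> is a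
  rational expression in the entries of \<open>F\<close> and \<open>G\<close>, and differentiating \<open>(1 - \<pi>) F p = 0\<close> and
  \<open>\<pi> G (1 - p) = 0\<close> gives \<open>p' = p B (1 - p) - (1 - p) A p\<close> whenever \<open>F' = F A\<close> and \<open>G' = G B\<close>.
  In the \<open>x\<close>-direction this is the claim.

  In the \<open>t\<close>-direction one needs \<open>T K = K S\<close>, where \<open>S = S(q)\<close>, \<open>T = S(q + 2\<alpha>[e,p])\<close> and
  \<open>K = \<lambda> + \<alpha>(1 - 2p)\<close> is the dressing factor without its denominator. The defect \<open>D = T K - K S\<close>
  solves a linear equation \<open>D' = D M - L D\<close>. Conjugating by a diagonal matrix of powers of \<open>z\<close>, where
  \<open>\<lambda> = z\<^sup>2\<^sup>n\<^sup>+\<^sup>1\<close>, makes all of \<open>S, T, M, L\<close> of the form \<open>z J + (lower order)\<close> with one constant matrix \<open>J\<close>.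
  The leading coefficient \<open>A\<close> of \<open>D\<close> therefore commutes with \<open>J\<close>. Both \<open>S\<close> and \<open>T\<close> satisfy
  \<open>X\<^sup>2\<^sup>n\<^sup>+\<^sup>2 = \<lambda> X\<close>, and comparing leading terms gives \<open>A = (2n+2) J\<^sup>2\<^sup>n\<^sup>+\<^sup>1 A\<close>, which forces \<open>A = 0\<close>.
  Evaluating the polynomial parts of \<open>T\<^sup>k K = K S\<^sup>k\<close> at \<open>\<lambda> = \<alpha>\<close> and \<open>\<lambda> = -\<alpha>\<close> gives the claim.
\<close>

section \<open>Square matrices\<close>

lemma sq_mat_closed:
  assumes "A \<in> carrier_mat N N" "B \<in> carrier_mat N N"
  shows "A * B \<in> carrier_mat N N" "A + B \<in> carrier_mat N N" "A - B \<in> carrier_mat N N"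
  using assms by auto

lemma sq_mat_closed1:
  assumes "A \<in> carrier_mat N N"
  shows "- A \<in> carrier_mat N N" "k \<cdot>\<^sub>m A \<in> carrier_mat N N" "A\<^sup>T \<in> carrier_mat N N"
  using assms by auto

lemma sq_mat_distrib:
  fixes A B C :: "'a::comm_ring_1 mat"
  assumes "A \<in> carrier_mat N N" "B \<in> carrier_mat N N" "C \<in> carrier_mat N N"
  shows "(A * B) * C = A * (B * C)"
    "A * (B + C) = A * B + A * C" "(A + B) * C = A * C + B * C"
    "A * (B - C) = A * B - A * C" "(A - B) * C = A * C - B * C"
  using assms by (auto simp: mult_add_distrib_mat[of _ N N] add_mult_distrib_mat[of _ N N]
      mult_minus_distrib_mat[of _ N N] minus_mult_distrib_mat[of _ N N])

lemma sq_mat_smult: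
  fixes A B :: "'a::comm_ring_1 mat"
  assumes "A \<in> carrier_mat N N" "B \<in> carrier_mat N N"
  shows "A * (k \<cdot>\<^sub>m B) = k \<cdot>\<^sub>m (A * B)" "(k \<cdot>\<^sub>m A) * B = k \<cdot>\<^sub>m (A * B)"
    "A * (- B) = - (A * B)" "(- A) * B = - (A * B)"
  using assms by auto

lemma sq_mat_unit:
  fixes A :: "'a::comm_ring_1 mat"
  assumes "A \<in> carrier_mat N N"
  shows "A * 1\<^sub>m N = A" "1\<^sub>m N * A = A" "A * 0\<^sub>m N N = 0\<^sub>m N N" "0\<^sub>m N N * A = 0\<^sub>m N N"
  using assms by auto

lemma sq_mat_index:
  assumes "A \<in> carrier_mat N N" "B \<in> carrier_mat N N" "r < N" "c < N"
  shows "(A + B) $$ (r,c) = A $$ (r,c) + B $$ (r,c)" "(A - B) $$ (r,c) = A $$ (r,c) - B $$ (r,c)"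
  using assms by auto

lemma sq_mat_index1:
  assumes "A \<in> carrier_mat N N" "r < N" "c < N"
  shows "(- A) $$ (r,c) = - A $$ (r,c)" "(k \<cdot>\<^sub>m A) $$ (r,c) = k * A $$ (r,c)"
  using assms by auto

lemma sq_mat_eqI:
  assumes "A \<in> carrier_mat N N" "B \<in> carrier_mat N N"
    and "\<And>r c. r < N \<Longrightarrow> c < N \<Longrightarrow> A $$ (r,c) = B $$ (r,c)"
  shows "A = B"
  using assms by (intro eq_matI) auto

text \<open>Together these expand both sides of a matrix identity into sums of right-associated
  words. Compared entrywise with \<open>index_mult_mat\<close> removed, the entries of the words are
  atoms and ring arithmetic finishes.\<close>

lemmas sq_mat_simps = sq_mat_closed sq_mat_closed1 sq_mat_distrib sq_mat_smult sq_mat_unit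
  sq_mat_index sq_mat_index1

lemma sq_mat_minus_eq_0:
  fixes A B :: "'a::comm_ring_1 mat"
  assumes "A \<in> carrier_mat N N" "B \<in> carrier_mat N N" "A - B = 0\<^sub>m N N"
  shows "A = B"
proof (rule sq_mat_eqI[OF assms(1,2)])
  fix r c assume "r < N" "c < N"
  then show "A $$ (r,c) = B $$ (r,c)"
    using arg_cong[OF assms(3), of "\<lambda>Z. Z $$ (r,c)"] assms(1,2) by (simp add: sq_mat_index[where N=N])
qed

lemma sq_mat_mult_index:
  assumes "A \<in> carrier_mat N N" "B \<in> carrier_mat N N" "r < N" "c < N"
  shows "(A * B) $$ (r,c) = (\<Sum>k<N. A $$ (r,k) * B $$ (k,c))"
  using assms by (auto simp: scalar_prod_def atLeast0LessThan)

lemma sq_mat_transpose_mult: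
  fixes A B :: "'a::comm_ring_1 mat"
  assumes "A \<in> carrier_mat N N" "B \<in> carrier_mat N N"
  shows "(A * B)\<^sup>T = B\<^sup>T * A\<^sup>T"
  using assms by (rule transpose_mult)

lemma sq_mat_transpose_minus:
  assumes "A \<in> carrier_mat N N" "B \<in> carrier_mat N N"
  shows "(A - B)\<^sup>T = A\<^sup>T - B\<^sup>T"
  using assms by (intro eq_matI) auto

section \<open>Differentiation of matrix functions\<close>

lemma mat_derivI:
  assumes "D \<in> carrier_mat N N"
    and "\<And>r c. r < N \<Longrightarrow> c < N \<Longrightarrow> ((\<lambda>s. f s $$ (r,c)) has_vector_derivative D $$ (r,c)) (at x)"
  shows "mat_deriv f D x"
  using assms unfolding mat_deriv_def by auto

lemma mat_derivD:
  assumes "mat_deriv f D x" "D \<in> carrier_mat N N" "r < N" "c < N"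
  shows "((\<lambda>s. f s $$ (r,c)) has_vector_derivative D $$ (r,c)) (at x)"
  using assms unfolding mat_deriv_def by auto

lemma mat_deriv_const: "A \<in> carrier_mat N N \<Longrightarrow> mat_deriv (\<lambda>s. A) (0\<^sub>m N N) x"
  by (rule mat_derivI[of _ N]) auto

lemma mat_deriv_mult:
  assumes f: "\<And>s. f s \<in> carrier_mat N N" and g: "\<And>s. g s \<in> carrier_mat N N"
    and D: "D \<in> carrier_mat N N" and E: "E \<in> carrier_mat N N"
    and df: "mat_deriv f D x" and dg: "mat_deriv g E x"
  shows "mat_deriv (\<lambda>s. f s * g s) (D * g x + f x * E) x"
proof (rule mat_derivI[of _ N])
  show "D * g x + f x * E \<in> carrier_mat N N" using f g D E by (simp add: sq_mat_simps[where N=N])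
  fix r c assume rc: "r < N" "c < N"
  have "((\<lambda>s. \<Sum>k<N. f s $$ (r,k) * g s $$ (k,c)) has_vector_derivative
      (\<Sum>k<N. f x $$ (r,k) * E $$ (k,c) + D $$ (r,k) * g x $$ (k,c))) (at x)"
    by (intro has_vector_derivative_sum has_vector_derivative_mult mat_derivD[OF df D]
        mat_derivD[OF dg E] rc) auto
  moreover have "(D * g x + f x * E) $$ (r,c) = (\<Sum>k<N. f x $$ (r,k) * E $$ (k,c) + D $$ (r,k) * g x $$ (k,c))"
    using f[of x] g[of x] D E rc
    by (simp add: sq_mat_index[where N=N] sq_mat_closed[where N=N] sq_mat_mult_index[where N=N] sum.distrib
        del: index_mult_mat)
  ultimately show "((\<lambda>s. (f s * g s) $$ (r,c)) has_vector_derivative (D * g x + f x * E) $$ (r,c)) (at x)"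
    by (simp add: sq_mat_mult_index[OF f g rc] del: index_mult_mat)
qed

lemma mat_deriv_mult_const:
  assumes f: "\<And>s. f s \<in> carrier_mat N N" and A: "A \<in> carrier_mat N N"
    and D: "D \<in> carrier_mat N N" and df: "mat_deriv f D x"
  shows "mat_deriv (\<lambda>s. A * f s) (A * D) x" "mat_deriv (\<lambda>s. f s * A) (D * A) x"
proof -
  note fx = f[of x]
  show "mat_deriv (\<lambda>s. A * f s) (A * D) x"
    using mat_deriv_mult[OF A f zero_carrier_mat D mat_deriv_const[OF A] df] fx A D by simp
  show "mat_deriv (\<lambda>s. f s * A) (D * A) x"
    using mat_deriv_mult[OF f A D zero_carrier_mat df mat_deriv_const[OF A]] fx A D by simp
qed

lemma mat_deriv_const_minus:
  assumes f: "\<And>s. f s \<in> carrier_mat N N" and A: "A \<in> carrier_mat N N"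
    and D: "D \<in> carrier_mat N N" and df: "mat_deriv f D x"
  shows "mat_deriv (\<lambda>s. A - f s) (- D) x"
proof (rule mat_derivI[of _ N])
  fix r c assume rc: "r < N" "c < N"
  have "((\<lambda>s. A $$ (r,c) - f s $$ (r,c)) has_vector_derivative 0 - D $$ (r,c)) (at x)"
    by (intro has_vector_derivative_diff has_vector_derivative_const mat_derivD[OF df D rc])
  then show "((\<lambda>s. (A - f s) $$ (r,c)) has_vector_derivative (- D) $$ (r,c)) (at x)"
    by (simp only: sq_mat_index(2)[OF A f rc] sq_mat_index1(1)[OF D rc] diff_0)
qed (rule sq_mat_closed1(1)[OF D])

lemma mat_deriv_transpose:
  assumes f: "\<And>s. f s \<in> carrier_mat N N" and D: "D \<in> carrier_mat N N" and df: "mat_deriv f D x"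
  shows "mat_deriv (\<lambda>s. (f s)\<^sup>T) (D\<^sup>T) x"
proof (rule mat_derivI[of _ N])
  fix r c assume rc: "r < N" "c < N"
  have "(f s)\<^sup>T $$ (r,c) = f s $$ (c,r)" for s using f[of s] rc by simp
  then show "((\<lambda>s. (f s)\<^sup>T $$ (r,c)) has_vector_derivative D\<^sup>T $$ (r,c)) (at x)"
    using mat_derivD[OF df D rc(2,1)] D rc by simp
qed (rule sq_mat_closed1(3)[OF D])

lemma mat_deriv_unique:
  assumes "D \<in> carrier_mat N N" "E \<in> carrier_mat N N" "mat_deriv f D x" "mat_deriv f E x"
  shows "D = E"
proof (rule sq_mat_eqI[OF assms(1,2)])
  fix r c assume rc: "r < N" "c < N"
  have "(\<lambda>h. h *\<^sub>R D $$ (r,c)) = (\<lambda>h. h *\<^sub>R E $$ (r,c))"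
    using mat_derivD[OF assms(3,1) rc] mat_derivD[OF assms(4,2) rc]
    unfolding has_vector_derivative_def by (rule has_derivative_unique)
  from fun_cong[OF this, of 1] show "D $$ (r,c) = E $$ (r,c)" by simp
qed

lemma mat_deriv_imp_differentiable:
  assumes "mat_deriv f D x" "D \<in> carrier_mat N N" "r < N" "c < N"
  shows "(\<lambda>s. f s $$ (r,c)) differentiable (at x)"
  using mat_derivD[OF assms] unfolding has_vector_derivative_def differentiable_def by blast

lemma differentiable_imp_mat_deriv:
  assumes "\<And>r c. r < N \<Longrightarrow> c < N \<Longrightarrow> (\<lambda>s. f s $$ (r,c)) differentiable (at x)"
  obtains D where "D \<in> carrier_mat N N" "mat_deriv f D x"
proof -
  have "\<forall>r c. \<exists>d. r < N \<longrightarrow> c < N \<longrightarrow> ((\<lambda>s. f s $$ (r,c)) has_vector_derivative d) (at x)"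
  proof (intro allI)
    fix r c
    show "\<exists>d. r < N \<longrightarrow> c < N \<longrightarrow> ((\<lambda>s. f s $$ (r,c)) has_vector_derivative d) (at x)"
    proof (cases "r < N \<and> c < N")
      case True
      then obtain h where h: "((\<lambda>s. f s $$ (r,c)) has_derivative h) (at x)"
        using assms[of r c] unfolding differentiable_def by blast
      then interpret bounded_linear h by (rule has_derivative_bounded_linear)
      have "h y = y *\<^sub>R h 1" for y using scaleR[of y 1] by (simp only: real_scaleR_def mult_1_right)
      then have "h = (\<lambda>y. y *\<^sub>R h 1)" by (rule ext)
      with h have "((\<lambda>s. f s $$ (r,c)) has_vector_derivative h 1) (at x)"
        unfolding has_vector_derivative_def by (rule has_derivative_eq_rhs)
      then show ?thesis by blast
    qed auto
  qed
  then obtain d where d: "\<And>r c. r < N \<Longrightarrow> c < N \<Longrightarrow>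
      ((\<lambda>s. f s $$ (r,c)) has_vector_derivative d r c) (at x)" by metis
  have "mat_deriv f (mat N N (\<lambda>(r,c). d r c)) x" by (rule mat_derivI[of _ N]) (auto simp: d)
  then show thesis by (rule that[rotated]) auto
qed

lemma differentiable_prod:
  fixes f :: "'i \<Rightarrow> real \<Rightarrow> complex"
  assumes "finite I" "\<And>i. i \<in> I \<Longrightarrow> f i differentiable (at x)"
  shows "(\<lambda>s. \<Prod>i\<in>I. f i s) differentiable (at x)"
  using assms by (induction I rule: finite_induct) auto

lemma differentiable_det:
  fixes f :: "real \<Rightarrow> complex mat"
  assumes f: "\<And>s. f s \<in> carrier_mat N N"
    and d: "\<And>r c. r < N \<Longrightarrow> c < N \<Longrightarrow> (\<lambda>s. f s $$ (r,c)) differentiable (at x)"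
  shows "(\<lambda>s. det (f s)) differentiable (at x)"
proof -
  have "(\<lambda>s. \<Sum>p\<in>{p. p permutes {0..<N}}. signof p * (\<Prod>i = 0..<N. f s $$ (i, p i))) differentiable (at x)"
  proof (intro differentiable_sum finite_permutations ballI differentiable_mult differentiable_const differentiable_prod)
    fix p i assume "p \<in> {p. p permutes {0..<N}}" "i \<in> {0..<N}"
    then have "i < N" "p i < N" using permutes_in_image[of p "{0..<N}" i] by auto
    then show "(\<lambda>s. f s $$ (i, p i)) differentiable (at x)" by (rule d)
  qed auto
  then show ?thesis by (simp add: det_def'[OF f])
qed

text \<open>Cofactors are signed determinants of submatrices, so Cramer's rule keeps
  differentiability.\<close>

lemma differentiable_adj_mat:
  fixes f :: "real \<Rightarrow> complex mat"
  assumes f: "\<And>s. f s \<in> carrier_mat N N"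
    and d: "\<And>r c. r < N \<Longrightarrow> c < N \<Longrightarrow> (\<lambda>s. f s $$ (r,c)) differentiable (at x)"
    and rc: "r < N" "c < N"
  shows "(\<lambda>s. adj_mat (f s) $$ (r,c)) differentiable (at x)"
proof -
  have "(\<lambda>s. det (mat_delete (f s) c r)) differentiable (at x)"
  proof (rule differentiable_det)
    show "mat_delete (f s) c r \<in> carrier_mat (N - 1) (N - 1)" for s
      by (rule mat_delete_carrier[OF f])
    fix i k assume ik: "i < N - 1" "k < N - 1"
    have "(\<lambda>s. mat_delete (f s) c r $$ (i,k)) =
        (\<lambda>s. f s $$ (if i < c then i else Suc i, if k < r then k else Suc k))"
      using ik carrier_matD[OF f] by (auto simp: mat_delete_def fun_eq_iff)
    moreover have "\<dots> differentiable (at x)" using ik rc by (intro d) auto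
    ultimately show "(\<lambda>s. mat_delete (f s) c r $$ (i,k)) differentiable (at x)" by simp
  qed
  then show ?thesis
    using rc carrier_matD[OF f] by (simp add: adj_mat_def cofactor_def)
qed

section \<open>Differentiating a projection with moving image and kernel\<close>

lemma projection_deriv:
  fixes f g fi gi p :: "real \<Rightarrow> complex mat"
  assumes cf: "\<And>s. f s \<in> carrier_mat N N" and cg: "\<And>s. g s \<in> carrier_mat N N"
    and cfi: "\<And>s. fi s \<in> carrier_mat N N" and cgi: "\<And>s. gi s \<in> carrier_mat N N"
    and cp: "\<And>s. p s \<in> carrier_mat N N" and cP: "P \<in> carrier_mat N N"
    and cA: "A \<in> carrier_mat N N" and cB: "B \<in> carrier_mat N N"
    and ffi: "\<And>s. f s * fi s = 1\<^sub>m N" and fif: "\<And>s. fi s * f s = 1\<^sub>m N"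
    and ggi: "\<And>s. g s * gi s = 1\<^sub>m N" and gig: "\<And>s. gi s * g s = 1\<^sub>m N"
    and PP: "P * P = P"
    and pfi: "\<And>s. p s * (fi s * P) = fi s * P"
    and pgi: "\<And>s. p s * (gi s * (1\<^sub>m N - P)) = 0\<^sub>m N N"
    and Pfp: "\<And>s. (1\<^sub>m N - P) * (f s * p s) = 0\<^sub>m N N"
    and Pgp: "\<And>s. P * (g s * (1\<^sub>m N - p s)) = 0\<^sub>m N N"
    and df: "mat_deriv f (f x * A) x" and dg: "mat_deriv g (g x * B) x"
    and dfi: "mat_deriv fi Dfi x" and dgi: "mat_deriv gi Dgi x"
    and cDfi: "Dfi \<in> carrier_mat N N" and cDgi: "Dgi \<in> carrier_mat N N"
  shows "mat_deriv p (p x * B * (1\<^sub>m N - p x) - (1\<^sub>m N - p x) * A * p x) x"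
proof -
  define Q where "Q = 1\<^sub>m N - P"
  have cQ[simp]: "Q \<in> carrier_mat N N" unfolding Q_def using cP by auto
  note [simp] = cf cg cfi cgi cp cP cA cB cDfi cDgi
  note R = sq_mat_simps[where N=N]
  \<comment> \<open>\<open>U\<close> maps \<open>Im P\<close> onto the image and \<open>ker P\<close> onto the kernel of the moving projection, so
    \<open>p U = U P\<close>; Cramer's rule for \<open>U\<close> then shows that \<open>p\<close> is differentiable.\<close>
  define U where "U s = fi s * P + gi s * Q" for s
  \<comment> \<open>\<open>V\<close> is a left inverse of \<open>U\<close>, which makes the
    denominator \<open>det (U s)\<close> in Cramer's rule nonzero.\<close>
  define V where "V s = f s * p s + g s * (1\<^sub>m N - p s)" for s
  have cU[simp]: "U s \<in> carrier_mat N N" and cV[simp]: "V s \<in> carrier_mat N N" for s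
    by (simp_all add: U_def V_def R)
  have pU: "p s * U s = fi s * P" for s
    using pfi[of s] pgi[of s] by (simp add: U_def Q_def[symmetric] R)
  have VU: "V s * U s = 1\<^sub>m N" for s
  proof -
    have "V s * U s = f s * (p s * U s) + (g s * U s - g s * (p s * U s))"
      unfolding V_def by (simp add: sq_mat_simps[where N=N])
    also have "\<dots> = (f s * fi s) * P + (g s * gi s) * Q"
      unfolding pU by (rule sq_mat_eqI[of _ N]) (simp_all add: U_def R del: index_mult_mat)
    also have "\<dots> = 1\<^sub>m N" unfolding ffi ggi
      by (rule sq_mat_eqI[of _ N]) (simp_all add: Q_def R)
    finally show ?thesis .
  qed
  have detU: "det (U s) \<noteq> 0" for s
    using det_mult[OF cV cU, of s s] VU[of s] by auto
  have dU: "mat_deriv U (Dfi * P + Dgi * Q) x"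
  proof (rule mat_derivI[of _ N])
    fix r c assume rc: "r < N" "c < N"
    have "((\<lambda>s. (fi s * P) $$ (r,c) + (gi s * Q) $$ (r,c)) has_vector_derivative
       (Dfi * P) $$ (r,c) + (Dgi * Q) $$ (r,c)) (at x)"
      by (intro has_vector_derivative_add mat_derivD[of _ _ _ N] rc mat_deriv_mult_const[where N=N] dfi dgi)
        (simp_all add: R)
    then show "((\<lambda>s. U s $$ (r,c)) has_vector_derivative (Dfi * P + Dgi * Q) $$ (r,c)) (at x)"
      using rc by (simp add: U_def R del: index_mult_mat)
  qed (simp add: R)
  have pdet: "p s $$ (r,c) = (fi s * P * adj_mat (U s)) $$ (r,c) / det (U s)" if rc: "r < N" "c < N" for s r c
  proof -
    have "fi s * P * adj_mat (U s) = p s * (U s * adj_mat (U s))"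
      using adj_mat(1)[OF cU[of s]] by (simp add: R pU[symmetric])
    also have "\<dots> = det (U s) \<cdot>\<^sub>m p s" unfolding adj_mat(2)[OF cU] by (simp add: R)
    finally show ?thesis using rc detU[of s] by (simp add: R del: index_mult_mat)
  qed
  have difU: "(\<lambda>s. U s $$ (r,c)) differentiable (at x)" if "r < N" "c < N" for r c
    using that by (intro mat_deriv_imp_differentiable[OF dU]) (simp_all add: R)
  have "(\<lambda>s. p s $$ (r,c)) differentiable (at x)" if rc: "r < N" "c < N" for r c
  proof -
    have a: "adj_mat (U s) \<in> carrier_mat N N" for s by (rule adj_mat(1)[OF cU])
    have "(\<lambda>s. (\<Sum>k<N. (fi s * P) $$ (r,k) * adj_mat (U s) $$ (k,c)) / det (U s)) differentiable (at x)"
      using rc detU by (intro differentiable_divide differentiable_sum ballI differentiable_mult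
          differentiable_adj_mat[of _ N] differentiable_det[of _ N] difU cU
          mat_deriv_imp_differentiable[OF mat_deriv_mult_const(2)[OF cfi cP cDfi dfi]])
        (simp_all add: R)
    moreover have "(fi s * P * adj_mat (U s)) $$ (r,c) = (\<Sum>k<N. (fi s * P) $$ (r,k) * adj_mat (U s) $$ (k,c))" for s
      by (rule sq_mat_mult_index[OF _ a rc]) (simp add: R)
    ultimately show ?thesis by (simp only: pdet[OF rc])
  qed
  then obtain D where cD[simp]: "D \<in> carrier_mat N N" and dp: "mat_deriv p D x"
    by (rule differentiable_imp_mat_deriv)
  \<comment> \<open>Once \<open>D\<close> exists, the product rule applies to
    \<open>Q * (f s * p s)\<close>, which vanishes for every \<open>s\<close>; uniqueness of
    derivatives gives the equation.\<close>
  have "Q * (f x * A * p x + f x * D) = 0\<^sub>m N N"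
  proof (rule mat_deriv_unique[of _ N])
    have "mat_deriv (\<lambda>s. f s * p s) (f x * A * p x + f x * D) x"
      by (rule mat_deriv_mult[where N=N]) (simp_all add: R df dp)
    then show "mat_deriv (\<lambda>s. Q * (f s * p s)) (Q * (f x * A * p x + f x * D)) x"
      by (intro mat_deriv_mult_const[where N=N]) (simp_all add: R)
    show "mat_deriv (\<lambda>s. Q * (f s * p s)) (0\<^sub>m N N) x"
      unfolding Q_def Pfp by (rule mat_deriv_const) simp
  qed (simp_all add: R)
  then have "fi x * (Q * (f x * A * p x + f x * D)) = fi x * 0\<^sub>m N N" by simp
  then have e1: "p x * (fi x * (Q * (f x * (A * p x + D)))) = 0\<^sub>m N N" 
      "fi x * (Q * (f x * (A * p x + D))) = 0\<^sub>m N N" by (simp_all add: R)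
  \<comment> \<open>\<open>fi P f\<close> and \<open>fi Q f\<close> add up to the identity. The
    second kills \<open>A p + D\<close>, which therefore lies in the range of \<open>fi P\<close>,
    where \<open>p\<close> acts as the identity.\<close>
  have X1: "p x * (A * p x + D) = A * p x + D"
  proof -
    define X where "X = A * p x + D"
    have cX[simp]: "X \<in> carrier_mat N N" by (simp add: X_def R)
    have "X = (fi x * f x) * X" by (simp only: fif sq_mat_unit(2)[OF cX])
    also have "\<dots> = fi x * P * (f x * X) + fi x * (Q * (f x * X))"
      by (rule sq_mat_eqI[of _ N]) (simp_all add: Q_def R del: index_mult_mat)
    also have "\<dots> = fi x * P * (f x * X)" using e1(2)[folded X_def] by (simp add: R)
    finally have X: "X = fi x * P * (f x * X)" .
    have "p x * X = (p x * (fi x * P)) * (f x * X)" by (subst X) (simp add: R)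
    also have "\<dots> = X" unfolding pfi using X by simp
    finally show ?thesis unfolding X_def .
  qed
  have "P * (g x * B * (1\<^sub>m N - p x) + g x * (- D)) = 0\<^sub>m N N"
  proof (rule mat_deriv_unique[of _ N])
    have "mat_deriv (\<lambda>s. 1\<^sub>m N - p s) (- D) x"
      by (rule mat_deriv_const_minus[where N=N]) (simp_all add: dp)
    then have "mat_deriv (\<lambda>s. g s * (1\<^sub>m N - p s)) (g x * B * (1\<^sub>m N - p x) + g x * (- D)) x"
      by (intro mat_deriv_mult[where N=N]) (simp_all add: R dg)
    then show "mat_deriv (\<lambda>s. P * (g s * (1\<^sub>m N - p s))) (P * (g x * B * (1\<^sub>m N - p x) + g x * (- D))) x"
      by (intro mat_deriv_mult_const[where N=N]) (simp_all add: R)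
    show "mat_deriv (\<lambda>s. P * (g s * (1\<^sub>m N - p s))) (0\<^sub>m N N) x"
      unfolding Pgp by (rule mat_deriv_const) simp
  qed (simp_all add: R)
  then have "gi x * (P * (g x * B * (1\<^sub>m N - p x) + g x * (- D))) = gi x * 0\<^sub>m N N" by simp
  then have e2: "gi x * (P * (g x * (B * (1\<^sub>m N - p x) - D))) = 0\<^sub>m N N"
    by (simp add: R minus_add_uminus_mat[of _ N N])
  \<comment> \<open>Dually, \<open>B (1 - p) - D\<close> lies in the range of \<open>gi Q\<close>,
    which \<open>p\<close> annihilates.\<close>
  have X2: "p x * (B * (1\<^sub>m N - p x) - D) = 0\<^sub>m N N"
  proof -
    define X where "X = B * (1\<^sub>m N - p x) - D"
    have cX[simp]: "X \<in> carrier_mat N N" by (simp add: X_def R)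
    have "X = (gi x * g x) * X" by (simp only: gig sq_mat_unit(2)[OF cX])
    also have "\<dots> = gi x * Q * (g x * X) + gi x * (P * (g x * X))"
      by (rule sq_mat_eqI[of _ N]) (simp_all add: Q_def R del: index_mult_mat)
    also have "\<dots> = gi x * Q * (g x * X)" using e2[folded X_def] by (simp add: R)
    finally have X: "X = gi x * Q * (g x * X)" .
    have "p x * X = (p x * (gi x * Q)) * (g x * X)" by (subst X) (simp add: R)
    also have "\<dots> = 0\<^sub>m N N" unfolding pgi Q_def by (simp add: R)
    finally show ?thesis unfolding X_def .
  qed
  \<comment> \<open>\<open>X1\<close> gives \<open>D = p A p + p D - A p\<close>, and
    \<open>X2\<close> gives \<open>p D = p B (1 - p)\<close>.\<close>
  have "D = p x * B * (1\<^sub>m N - p x) - (1\<^sub>m N - p x) * A * p x"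
  proof (rule sq_mat_eqI[of _ N])
    fix r c assume rc: "r < N" "c < N"
    note i1 = arg_cong[OF X1, of "\<lambda>M. M $$ (r,c)"] and i2 = arg_cong[OF X2, of "\<lambda>M. M $$ (r,c)"]
    show "D $$ (r,c) = (p x * B * (1\<^sub>m N - p x) - (1\<^sub>m N - p x) * A * p x) $$ (r,c)"
      using i1 i2 rc by (simp add: R algebra_simps del: index_mult_mat)
  qed (simp_all add: R)
  then show ?thesis using dp by simp
qed

no_notation fls_nth (infixl "$$" 75)
no_notation fps_nth (infixl "$" 75)

section \<open>Matrix series\<close>

abbreviation ser_carrier :: "nat \<Rightarrow> mser \<Rightarrow> bool" where
  "ser_carrier N A \<equiv> (\<forall>k. A k \<in> carrier_mat N N)"

lemma ser_mult_carrier [simp]: "ser_mult N A B k \<in> carrier_mat N N"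
  by (simp add: ser_mult_def)

lemma ser_pow_carrier [simp]: "ser_pow N A p k \<in> carrier_mat N N"
  by (cases p) (simp_all add: ser_one_def)

text \<open>The sum in \<open>ser_mult\<close> runs over the exact support; enlarging it to a
  convenient range adds only zero products, and finiteness of that range rules out the default value
  of an infinite sum.\<close>

lemma ser_mult_index:
  assumes "ser_carrier N A" "ser_carrier N B" "r < N" "c < N" "finite T"
    and T: "\<And>i. A i \<noteq> 0\<^sub>m N N \<Longrightarrow> B (k - i) \<noteq> 0\<^sub>m N N \<Longrightarrow> i \<in> T"
  shows "ser_mult N A B k $$ (r,c) = (\<Sum>i\<in>T. (A i * B (k - i)) $$ (r,c))"
proof -
  have "(A i * B (k - i)) $$ (r,c) = 0" if "A i = 0\<^sub>m N N \<or> B (k - i) = 0\<^sub>m N N" for i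
  proof -
    have "A i * B (k - i) = 0\<^sub>m N N"
      using that sq_mat_unit(3)[of "A i" N] sq_mat_unit(4)[of "B (k - i)" N] assms(1,2) by auto
    then show ?thesis using assms(3,4) by simp
  qed
  then have "(\<Sum>i\<in>{i. A i \<noteq> 0\<^sub>m N N \<and> B (k - i) \<noteq> 0\<^sub>m N N}. (A i * B (k - i)) $$ (r,c))
     = (\<Sum>i\<in>T. (A i * B (k - i)) $$ (r,c))"
    using T by (intro sum.mono_neutral_left assms) auto
  then show ?thesis using assms(3,4) by (simp add: ser_mult_def)
qed

text \<open>The form shared by \<open>J\<close>, \<open>J + q\<close> and the dressing
  factor.\<close>

definition ser_linear :: "nat \<Rightarrow> complex mat \<Rightarrow> complex mat \<Rightarrow> mser" where
  "ser_linear N A1 A0 k = (if k = 1 then A1 else if k = 0 then A0 else 0\<^sub>m N N)"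

lemma ser_linear_carrier [simp]:
  "A1 \<in> carrier_mat N N \<Longrightarrow> A0 \<in> carrier_mat N N \<Longrightarrow> ser_linear N A1 A0 k \<in> carrier_mat N N"
  by (simp add: ser_linear_def)

lemma ser_bdd_linear [simp]: "ser_bdd N (ser_linear N A1 A0)"
  unfolding ser_bdd_def ser_linear_def by (rule exI[of _ 1]) auto

lemma ser_mult_linear_right:
  assumes W: "ser_carrier N W" and A: "A1 \<in> carrier_mat N N" "A0 \<in> carrier_mat N N"
  shows "ser_mult N W (ser_linear N A1 A0) k = W (k - 1) * A1 + W k * A0"
proof (rule sq_mat_eqI[of _ N])
  fix r c assume rc: "r < N" "c < N"
  have "ser_mult N W (ser_linear N A1 A0) k $$ (r,c)
      = (\<Sum>i\<in>{k - 1, k}. (W i * ser_linear N A1 A0 (k - i)) $$ (r,c))"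
    by (rule ser_mult_index) (use assms rc in \<open>auto simp: ser_linear_def split: if_splits\<close>)
  also have "\<dots> = (W (k - 1) * A1 + W k * A0) $$ (r,c)"
    using assms rc by (simp add: ser_linear_def sq_mat_simps[where N=N] del: index_mult_mat)
  finally show "ser_mult N W (ser_linear N A1 A0) k $$ (r,c) = (W (k - 1) * A1 + W k * A0) $$ (r,c)" .
qed (use assms in \<open>auto simp: sq_mat_simps[where N=N]\<close>)

lemma ser_mult_linear_left:
  assumes W: "ser_carrier N W" and A: "A1 \<in> carrier_mat N N" "A0 \<in> carrier_mat N N"
  shows "ser_mult N (ser_linear N A1 A0) W k = A1 * W (k - 1) + A0 * W k"
proof (rule sq_mat_eqI[of _ N])
  fix r c assume rc: "r < N" "c < N"
  have "ser_mult N (ser_linear N A1 A0) W k $$ (r,c)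
      = (\<Sum>i\<in>{1, 0}. (ser_linear N A1 A0 i * W (k - i)) $$ (r,c))"
    by (rule ser_mult_index) (use assms rc in \<open>auto simp: ser_linear_def split: if_splits\<close>)
  also have "\<dots> = (A1 * W (k - 1) + A0 * W k) $$ (r,c)"
    using assms rc by (simp add: ser_linear_def sq_mat_simps[where N=N] del: index_mult_mat)
  finally show "ser_mult N (ser_linear N A1 A0) W k $$ (r,c) = (A1 * W (k - 1) + A0 * W k) $$ (r,c)" .
qed (use assms in \<open>auto simp: sq_mat_simps[where N=N]\<close>)

lemma ser_bdd_mult:
  assumes "ser_bdd N A" "ser_bdd N B"
  shows "ser_bdd N (ser_mult N A B)"
proof -
  obtain a b where a: "\<And>i. i > a \<Longrightarrow> A i = 0\<^sub>m N N" and b: "\<And>i. i > b \<Longrightarrow> B i = 0\<^sub>m N N"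
    using assms unfolding ser_bdd_def by blast
  have "ser_mult N A B k = 0\<^sub>m N N" if k: "k > a + b" for k
  proof -
    have "i > a \<or> k - i > b" for i using k by linarith
    then have e: "{i. A i \<noteq> 0\<^sub>m N N \<and> B (k - i) \<noteq> 0\<^sub>m N N} = {}" using a b by blast
    show ?thesis unfolding ser_mult_def e by (intro eq_matI) auto
  qed
  then show ?thesis unfolding ser_bdd_def by blast
qed

lemma ser_bdd_pow:
  assumes "ser_bdd N A"
  shows "ser_bdd N (ser_pow N A p)"
proof (induction p)
  case 0
  show ?case unfolding ser_bdd_def by (rule exI[of _ 0]) (simp add: ser_one_def)
qed (simp add: ser_bdd_mult assms)

section \<open>Graded Laurent matrices\<close>

text \<open>The range of the convolution is fixed in advance and not by the subdegrees, which may
  jump when the series depend on a parameter.\<close>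

lemma fls_times_nth_lower_bounds:
  fixes f g :: "'a::comm_ring_1 fls"
  assumes f: "\<And>i. i < a \<Longrightarrow> fls_nth f i = 0" and g: "\<And>i. i < b \<Longrightarrow> fls_nth g i = 0"
  shows "fls_nth (f * g) n = (\<Sum>i=a..n - b. fls_nth f i * fls_nth g (n - i))"
proof (cases "f = 0 \<or> g = 0")
  case False
  then have "a \<le> fls_subdegree f" "b \<le> fls_subdegree g"
    using f g nth_fls_subdegree_nonzero by (meson not_le)+
  moreover have "fls_nth (f * g) n
      = (\<Sum>i=fls_subdegree f..n - fls_subdegree g. fls_nth f i * fls_nth g (n - i))"
    by (rule fls_times_nth(2))
  ultimately show ?thesis
    by (auto intro!: sum.mono_neutral_left simp: not_le)
qed auto

text \<open>The sign turns a series bounded above in lambda into a Laurent series in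
  1/lambda.\<close>

definition entry_fls :: "mser \<Rightarrow> nat \<Rightarrow> nat \<Rightarrow> complex fls" where
  "entry_fls A r c = Abs_fls (\<lambda>i. A (- i) $$ (r,c))"

lemma entry_fls_nth:
  assumes "ser_bdd N A" "r < N" "c < N"
  shows "fls_nth (entry_fls A r c) i = A (- i) $$ (r,c)"
proof -
  obtain a where a: "\<And>i. i > a \<Longrightarrow> A i = 0\<^sub>m N N" using assms unfolding ser_bdd_def by blast
  show ?thesis unfolding entry_fls_def
    by (rule nth_Abs_fls_lower_bound[of "- a"]) (use a assms in auto)
qed

lemma entry_fls_mult:
  assumes bA: "ser_bdd N A" and bB: "ser_bdd N B" and cA: "ser_carrier N A" and cB: "ser_carrier N B"
    and rc: "r < N" "c < N"
  shows "entry_fls (ser_mult N A B) r c = (\<Sum>s<N. entry_fls A r s * entry_fls B s c)"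
proof (rule fls_eqI)
  fix n
  obtain a b where a: "\<And>i. i > a \<Longrightarrow> A i = 0\<^sub>m N N" and b: "\<And>i. i > b \<Longrightarrow> B i = 0\<^sub>m N N"
    using bA bB unfolding ser_bdd_def by blast
  have *: "i \<in> {- n - b..a}" if "A i \<noteq> 0\<^sub>m N N" "B (- n - i) \<noteq> 0\<^sub>m N N" for i
    using a[of i] b[of "- n - i"] that by force
  have "fls_nth (entry_fls (ser_mult N A B) r c) n = ser_mult N A B (- n) $$ (r,c)"
    by (rule entry_fls_nth[OF ser_bdd_mult[OF bA bB] rc])
  also have "\<dots> = (\<Sum>i=- n - b..a. (A i * B (- n - i)) $$ (r,c))"
    by (rule ser_mult_index[OF cA cB rc]) (use * in auto)
  also have "\<dots> = (\<Sum>i=- n - b..a. \<Sum>s<N. A i $$ (r,s) * B (- n - i) $$ (s,c))"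
    using cA cB rc by (simp add: sq_mat_mult_index[where N=N] del: index_mult_mat)
  also have "\<dots> = (\<Sum>s<N. \<Sum>i=- n - b..a. A i $$ (r,s) * B (- n - i) $$ (s,c))"
    by (rule sum.swap)
  also have "\<dots> = (\<Sum>s<N. fls_nth (entry_fls A r s * entry_fls B s c) n)"
  proof (rule sum.cong[OF refl])
    fix s assume "s \<in> {..<N}"
    then have s: "s < N" by simp
    have "fls_nth (entry_fls A r s * entry_fls B s c) n
       = (\<Sum>i=- a..n - (- b). fls_nth (entry_fls A r s) i * fls_nth (entry_fls B s c) (n - i))"
      by (rule fls_times_nth_lower_bounds) (use a b rc s in \<open>simp_all add: entry_fls_nth[OF bA] entry_fls_nth[OF bB]\<close>)
    also have "\<dots> = (\<Sum>i=- a..n + b. A (- i) $$ (r,s) * B (- n + i) $$ (s,c))"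
      using rc s by (simp add: entry_fls_nth[OF bA] entry_fls_nth[OF bB])
    also have "\<dots> = (\<Sum>i=- n - b..a. A i $$ (r,s) * B (- n - i) $$ (s,c))"
      by (rule sum.reindex_bij_witness[of _ uminus uminus]) auto
    finally show "(\<Sum>i=- n - b..a. A i $$ (r,s) * B (- n - i) $$ (s,c))
       = fls_nth (entry_fls A r s * entry_fls B s c) n" by simp
  qed
  finally show "fls_nth (entry_fls (ser_mult N A B) r c) n
      = fls_nth (\<Sum>s<N. entry_fls A r s * entry_fls B s c) n"
    by (simp add: fls_nth_sum)
qed

text \<open>The Laurent variable is \<open>1/z\<close>, with \<open>\<lambda> = z\<^sup>d\<close>; the shift conjugates by \<open>diag(z\<^bsup>w r\<^esup>)\<close>, so that
  the entry \<open>(r,c)\<close> of the coefficient of \<open>\<lambda>\<^sup>k\<close> has degree \<open>d k + w r - w c\<close> in \<open>z\<close>.\<close>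

definition graded :: "nat \<Rightarrow> nat \<Rightarrow> (nat \<Rightarrow> int) \<Rightarrow> mser \<Rightarrow> complex fls mat" where
  "graded N d w A = mat N N (\<lambda>(r,c). fls_shift (w r - w c) (fls_compose_power (entry_fls A r c) d))"

lemma graded_carrier [simp]: "graded N d w A \<in> carrier_mat N N"
  by (simp add: graded_def)

lemma graded_nth:
  assumes "d > 0" "ser_bdd N A" "r < N" "c < N"
  shows "fls_nth (graded N d w A $$ (r,c)) i =
    (if int d dvd i + (w r - w c) then A (- ((i + (w r - w c)) div int d)) $$ (r,c) else 0)"
  using assms by (simp add: graded_def fls_nth_compose_power entry_fls_nth)

text \<open>Substituting \<open>z^d\<close> for lambda is multiplicative, and the shifts telescope:
  \<open>(w r - w s) + (w s - w c) = w r - w c\<close>.\<close>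

lemma graded_mult:
  assumes d: "d > 0" and A: "ser_bdd N A" "ser_carrier N A" and B: "ser_bdd N B" "ser_carrier N B"
  shows "graded N d w (ser_mult N A B) = graded N d w A * graded N d w B"
proof (rule sq_mat_eqI[of _ N])
  fix r c assume rc: "r < N" "c < N"
  have sum1: "fls_compose_power (\<Sum>s<M. f s) d = (\<Sum>s<M. fls_compose_power (f s) d)" for f :: "nat \<Rightarrow> complex fls" and M
    by (induction M) auto
  have sum2: "fls_shift k (\<Sum>s<M. f s) = (\<Sum>s<M. fls_shift k (f s))" for f :: "nat \<Rightarrow> complex fls" and M k
    by (induction M) auto
  have sh: "fls_shift (w r - w c) (f * g) = fls_shift (w r - w s) f * fls_shift (w s - w c) g" for f g :: "complex fls" and s
    by (simp add: fls_times_both_shifted_simp)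
  have "graded N d w (ser_mult N A B) $$ (r,c)
      = fls_shift (w r - w c) (fls_compose_power (\<Sum>s<N. entry_fls A r s * entry_fls B s c) d)"
    using rc by (simp add: graded_def entry_fls_mult[OF A(1) B(1) A(2) B(2)])
  also have "\<dots> = (\<Sum>s<N. fls_shift (w r - w s) (fls_compose_power (entry_fls A r s) d)
      * fls_shift (w s - w c) (fls_compose_power (entry_fls B s c) d))"
    unfolding sum1 sum2 fls_compose_power_mult by (intro sum.cong refl sh)
  also have "\<dots> = (graded N d w A * graded N d w B) $$ (r,c)"
    using rc by (simp add: sq_mat_mult_index[where N=N] graded_def del: index_mult_mat)
  finally show "graded N d w (ser_mult N A B) $$ (r,c) = (graded N d w A * graded N d w B) $$ (r,c)" .
qed (simp_all add: sq_mat_closed)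

text \<open>Every entry of every coefficient occupies its own power of z, so identities proved for
  graded matrices can be read back as identities of series.\<close>

lemma graded_inject:
  assumes d: "d > 0" and A: "ser_bdd N A" "ser_carrier N A" and B: "ser_bdd N B" "ser_carrier N B"
    and eq: "graded N d w A = graded N d w B"
  shows "A = B"
proof (rule ext, rule sq_mat_eqI[of _ N])
  fix k r c assume rc: "r < N" "c < N"
  define i where "i = - k * int d - (w r - w c)"
  have i: "i + (w r - w c) = - k * int d" by (simp add: i_def)
  have q: "(i + (w r - w c)) div int d = - k"
    unfolding i using d by (intro nonzero_mult_div_cancel_right) simp
  have "int d dvd i + (w r - w c)" unfolding i by simp
  moreover from eq have "fls_nth (graded N d w A $$ (r,c)) i = fls_nth (graded N d w B $$ (r,c)) i" by simp
  ultimately show "A k $$ (r,c) = B k $$ (r,c)"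
    by (simp add: graded_nth[OF d A(1) rc] graded_nth[OF d B(1) rc] q)
qed (use A B in auto)

lemma graded_pow:
  assumes d: "d > 0" and A: "ser_bdd N A" "ser_carrier N A"
  shows "graded N d w (ser_pow N A p) = graded N d w A ^\<^sub>m p"
proof (induction p)
  case 0
  have b: "ser_bdd N (ser_one N)" using ser_bdd_pow[OF A(1), of 0] by simp
  have "graded N d w (ser_one N) = 1\<^sub>m N"
  proof (rule sq_mat_eqI[of _ N])
    fix r c assume rc: "r < N" "c < N"
    show "graded N d w (ser_one N) $$ (r,c) = 1\<^sub>m N $$ (r,c)"
      by (rule fls_eqI) (use d rc in \<open>auto simp: graded_nth[OF d b rc] ser_one_def\<close>)
  qed simp_all
  then show ?case by (simp add: graded_def)
next
  case (Suc p)
  then show ?case by (simp add: graded_mult[OF d] ser_bdd_pow A)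
qed

section \<open>Leading coefficients of Laurent matrices\<close>

text \<open>Index \<open>i\<close> belongs to \<open>z^(-i)\<close>: the bound \<open>a\<close> says
  that the degree in z is at most \<open>-a\<close>, and for \<open>a = -1\<close> the leading
  coefficient is that of z itself.\<close>

definition flm_ge :: "nat \<Rightarrow> int \<Rightarrow> complex fls mat \<Rightarrow> bool" where
  "flm_ge N a Z \<longleftrightarrow> (\<forall>r<N. \<forall>c<N. \<forall>i<a. fls_nth (Z $$ (r,c)) i = 0)"

definition flm_coeff :: "nat \<Rightarrow> complex fls mat \<Rightarrow> int \<Rightarrow> complex mat" where
  "flm_coeff N Z i = mat N N (\<lambda>(r,c). fls_nth (Z $$ (r,c)) i)"

lemma flm_geD: "flm_ge N a Z \<Longrightarrow> r < N \<Longrightarrow> c < N \<Longrightarrow> i < a \<Longrightarrow> fls_nth (Z $$ (r,c)) i = 0"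
  by (simp add: flm_ge_def)

lemma flm_ge_mono: "flm_ge N b Z \<Longrightarrow> a \<le> b \<Longrightarrow> flm_ge N a Z"
  by (auto simp: flm_ge_def)

lemma flm_coeff_carrier [simp]: "flm_coeff N Z i \<in> carrier_mat N N"
  by (simp add: flm_coeff_def)

lemma flm_coeff_index: "r < N \<Longrightarrow> c < N \<Longrightarrow> flm_coeff N Z i $$ (r,c) = fls_nth (Z $$ (r,c)) i"
  by (simp add: flm_coeff_def)

lemma flm_coeff_below: "flm_ge N a Z \<Longrightarrow> i < a \<Longrightarrow> flm_coeff N Z i = 0\<^sub>m N N"
  by (rule sq_mat_eqI[of _ N]) (simp_all add: flm_coeff_index flm_geD)

lemma flm_coeff_zero: "flm_coeff N (0\<^sub>m N N) i = 0\<^sub>m N N"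
  by (rule sq_mat_eqI[of _ N]) (simp_all add: flm_coeff_index)

lemma flm_coeff_add:
  "A \<in> carrier_mat N N \<Longrightarrow> B \<in> carrier_mat N N \<Longrightarrow> flm_coeff N (A + B) i = flm_coeff N A i + flm_coeff N B i"
  by (intro sq_mat_eqI[of _ N]) (simp_all add: flm_coeff_index sq_mat_simps[where N=N])

lemma flm_coeff_minus:
  "A \<in> carrier_mat N N \<Longrightarrow> B \<in> carrier_mat N N \<Longrightarrow> flm_coeff N (A - B) i = flm_coeff N A i - flm_coeff N B i"
  by (intro sq_mat_eqI[of _ N]) (simp_all add: flm_coeff_index sq_mat_simps[where N=N])

lemma flm_ge_add:
  "A \<in> carrier_mat N N \<Longrightarrow> B \<in> carrier_mat N N \<Longrightarrow> flm_ge N a A \<Longrightarrow> flm_ge N a B \<Longrightarrow> flm_ge N a (A + B)"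
  by (auto simp: flm_ge_def)

lemma flm_ge_minus:
  "A \<in> carrier_mat N N \<Longrightarrow> B \<in> carrier_mat N N \<Longrightarrow> flm_ge N a A \<Longrightarrow> flm_ge N a B \<Longrightarrow> flm_ge N a (A - B)"
  by (auto simp: flm_ge_def)

text \<open>\<open>fls_shift k 1\<close> is the monomial \<open>z^k\<close>.\<close>

lemma flm_smult_X:
  assumes "A \<in> carrier_mat N N"
  shows "flm_coeff N (fls_shift k 1 \<cdot>\<^sub>m A) i = flm_coeff N A (i + k)"
  using assms by (intro sq_mat_eqI[of _ N]) (auto simp: flm_coeff_index fls_shifted_times_simps(2))

lemma fls_mult_lower_bounds:
  fixes f g :: "complex fls"
  assumes f: "\<And>i. i < a \<Longrightarrow> fls_nth f i = 0" and g: "\<And>i. i < b \<Longrightarrow> fls_nth g i = 0"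
  shows "i < a + b \<Longrightarrow> fls_nth (f * g) i = 0" "fls_nth (f * g) (a + b) = fls_nth f a * fls_nth g b"
  by (simp_all add: fls_times_nth_lower_bounds[OF f g])

lemma flm_mult:
  assumes A: "A \<in> carrier_mat N N" "flm_ge N a A" and B: "B \<in> carrier_mat N N" "flm_ge N b B"
  shows "flm_ge N (a + b) (A * B)" "flm_coeff N (A * B) (a + b) = flm_coeff N A a * flm_coeff N B b"
proof -
  show "flm_ge N (a + b) (A * B)"
    unfolding flm_ge_def
    by (auto simp: sq_mat_mult_index[OF A(1) B(1)] fls_nth_sum simp del: index_mult_mat
        intro!: sum.neutral fls_mult_lower_bounds(1)[of a _ b] flm_geD[OF A(2)] flm_geD[OF B(2)])
  show "flm_coeff N (A * B) (a + b) = flm_coeff N A a * flm_coeff N B b"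
  proof (rule sq_mat_eqI[of _ N])
    fix r c assume rc: "r < N" "c < N"
    have "fls_nth (A $$ (r,k) * B $$ (k,c)) (a + b) = fls_nth (A $$ (r,k)) a * fls_nth (B $$ (k,c)) b"
      if "k < N" for k
      by (rule fls_mult_lower_bounds(2)) (use that rc A B flm_geD in blast)+
    then show "flm_coeff N (A * B) (a + b) $$ (r,c) = (flm_coeff N A a * flm_coeff N B b) $$ (r,c)"
      using rc A B by (simp add: flm_coeff_index sq_mat_mult_index[where N=N] fls_nth_sum del: index_mult_mat)
  qed (simp_all add: sq_mat_closed)
qed

lemma flm_ge_Suc: "flm_ge N a Z \<Longrightarrow> flm_coeff N Z a = 0\<^sub>m N N \<Longrightarrow> flm_ge N (a + 1) Z"
  unfolding flm_ge_def by (metis flm_coeff_index index_zero_mat(1) zless_add1_eq)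

lemma flm_ge_exists: "\<exists>a. flm_ge N a Z"
proof -
  \<comment> \<open>The inserted 0 keeps the minimum defined when \<open>N = 0\<close>.\<close>
  define a where "a = Min (insert 0 ((\<lambda>(r,c). fls_subdegree (Z $$ (r,c))) ` ({..<N} \<times> {..<N})))"
  have "a \<le> fls_subdegree (Z $$ (r,c))" if "r < N" "c < N" for r c
    unfolding a_def using that by (intro Min_le) force+
  then have "flm_ge N a Z" unfolding flm_ge_def by (blast intro: fls_eq0_below_subdegree less_le_trans)
  then show ?thesis by blast
qed

text \<open>Each vanishing leading coefficient raises the order by one, so any initial bound is
  pushed up to \<open>c\<close> in finitely many steps.\<close>

lemma flm_ge_induct:
  assumes "flm_ge N a Z" and step: "\<And>b. b < c \<Longrightarrow> flm_ge N b Z \<Longrightarrow> flm_coeff N Z b = 0\<^sub>m N N"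
  shows "flm_ge N c Z"
proof -
  have "flm_ge N (a + int k) Z" if "a + int k \<le> c" for k
    using that
  proof (induction k)
    case (Suc k)
    then have "flm_ge N (a + int k + 1) Z" by (intro flm_ge_Suc step) auto
    then show ?case by (simp add: algebra_simps)
  qed (use assms in simp)
  from this[of "nat (c - a)"] show ?thesis using flm_ge_mono[OF assms(1), of c] by (cases "c \<le> a") auto
qed

lemma flm_eq_0:
  assumes "Z \<in> carrier_mat N N" "\<And>c. flm_ge N c Z"
  shows "Z = 0\<^sub>m N N"
proof (rule sq_mat_eqI[of _ N])
  fix r c assume rc: "r < N" "c < N"
  have "fls_nth (Z $$ (r,c)) i = 0" for i using flm_geD[OF assms(2) rc, of i "i + 1"] by simp
  then show "Z $$ (r,c) = 0\<^sub>m N N $$ (r,c)" using rc by (auto intro: fls_eqI)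
qed (use assms in auto)

text \<open>The leading term of \<open>G\<close> is the identity, so \<open>Z * G\<close> and
  \<open>Z\<close> have the same leading coefficient. This takes the place of multiplying by an
  inverse of \<open>G\<close>.\<close>

lemma flm_right_cancel:
  assumes Z: "Z \<in> carrier_mat N N" and G: "G \<in> carrier_mat N N" "flm_ge N 0 G" "flm_coeff N G 0 = 1\<^sub>m N"
    and eq: "Z * G = 0\<^sub>m N N"
  shows "Z = 0\<^sub>m N N"
proof (rule flm_eq_0[OF Z])
  fix c
  obtain a where "flm_ge N a Z" using flm_ge_exists by blast
  then show "flm_ge N c Z"
  proof (rule flm_ge_induct)
    fix b assume "flm_ge N b Z"
    then have "flm_coeff N (Z * G) (b + 0) = flm_coeff N Z b * 1\<^sub>m N"
      using flm_mult(2)[OF Z _ G(1,2)] G(3) by metis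
    then show "flm_coeff N Z b = 0\<^sub>m N N"
      using eq by (simp add: sq_mat_unit[where N=N] flm_coeff_zero)
  qed
qed

lemma pow_mat_closed [simp]: "A \<in> carrier_mat N N \<Longrightarrow> A ^\<^sub>m k \<in> carrier_mat N N"
  by (rule pow_carrier_mat)

lemma flm_pow:
  assumes A: "A \<in> carrier_mat N N" "flm_ge N (- 1) A"
  shows "flm_ge N (- int k) (A ^\<^sub>m k) \<and> flm_coeff N (A ^\<^sub>m k) (- int k) = flm_coeff N A (- 1) ^\<^sub>m k"
proof (induction k)
  case 0
  have "flm_ge N 0 (1\<^sub>m N)" "flm_coeff N (1\<^sub>m N) 0 = 1\<^sub>m N"
    by (auto simp: flm_ge_def flm_coeff_def)
  then show ?case using A(1) by (simp add: carrier_matD[OF flm_coeff_carrier])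
next
  case (Suc k)
  have i: "- int (Suc k) = - int k + - 1" by simp
  show ?case unfolding i using Suc flm_mult[of "A ^\<^sub>m k" N "- int k" A "- 1"] A by simp
qed

section \<open>Coefficientwise parameter derivatives of Laurent matrices\<close>

definition flm_deriv :: "nat \<Rightarrow> (real \<Rightarrow> complex fls mat) \<Rightarrow> complex fls mat \<Rightarrow> real \<Rightarrow> bool" where
  "flm_deriv N f D x \<longleftrightarrow> (\<forall>r<N. \<forall>c<N. \<forall>i.
     ((\<lambda>s. fls_nth (f s $$ (r,c)) i) has_vector_derivative fls_nth (D $$ (r,c)) i) (at x))"

text \<open>Through this fact an order bound that holds for a whole family passes to its
  derivative.\<close>

lemma flm_deriv_eq_0:
  assumes "flm_deriv N f D x" "r < N" "c < N" "\<And>s. fls_nth (f s $$ (r,c)) i = 0"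
  shows "fls_nth (D $$ (r,c)) i = 0"
proof -
  have "((\<lambda>s. 0) has_vector_derivative fls_nth (D $$ (r,c)) i) (at x)"
    using assms unfolding flm_deriv_def by (metis (no_types, lifting) has_vector_derivative_eq_rhs ext)
  then have "(\<lambda>h. h *\<^sub>R fls_nth (D $$ (r,c)) i) = (\<lambda>h. 0)"
    unfolding has_vector_derivative_def by (rule has_derivative_unique) (rule has_derivative_const)
  from fun_cong[OF this, of 1] show ?thesis by simp
qed

text \<open>Since \<open>a\<close> and \<open>b\<close> are uniform in the parameter, each
  coefficient of the product is a finite sum with a fixed range, and the ordinary product rule
  applies.\<close>

lemma flm_deriv_mult:
  assumes f: "\<And>s. f s \<in> carrier_mat N N" "\<And>s. flm_ge N a (f s)"
    and g: "\<And>s. g s \<in> carrier_mat N N" "\<And>s. flm_ge N b (g s)"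
    and D: "D \<in> carrier_mat N N" and E: "E \<in> carrier_mat N N"
    and df: "flm_deriv N f D x" and dg: "flm_deriv N g E x"
  shows "flm_deriv N (\<lambda>s. f s * g s) (D * g x + f x * E) x"
  unfolding flm_deriv_def
proof (intro allI impI)
  fix r c i assume rc: "r < N" "c < N"
  have gD: "flm_ge N a D" and gE: "flm_ge N b E"
    unfolding flm_ge_def using flm_deriv_eq_0[OF df] flm_deriv_eq_0[OF dg] flm_geD[OF f(2)] flm_geD[OF g(2)] by auto
  have nth: "fls_nth ((A * B) $$ (r,c)) i
     = (\<Sum>k<N. \<Sum>j=a..i - b. fls_nth (A $$ (r,k)) j * fls_nth (B $$ (k,c)) (i - j))"
    if "A \<in> carrier_mat N N" "B \<in> carrier_mat N N" "flm_ge N a A" "flm_ge N b B" for A B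
    using rc by (auto simp: sq_mat_mult_index[OF that(1,2)] fls_nth_sum simp del: index_mult_mat
        intro!: sum.cong fls_times_nth_lower_bounds flm_geD[OF that(3)] flm_geD[OF that(4)])
  have "((\<lambda>s. \<Sum>k<N. \<Sum>j=a..i - b. fls_nth (f s $$ (r,k)) j * fls_nth (g s $$ (k,c)) (i - j))
     has_vector_derivative
      (\<Sum>k<N. \<Sum>j=a..i - b. fls_nth (f x $$ (r,k)) j * fls_nth (E $$ (k,c)) (i - j)
        + fls_nth (D $$ (r,k)) j * fls_nth (g x $$ (k,c)) (i - j))) (at x)"
    using df dg rc unfolding flm_deriv_def
    by (intro has_vector_derivative_sum has_vector_derivative_mult) auto
  moreover have "fls_nth ((D * g x + f x * E) $$ (r,c)) i
     = (\<Sum>k<N. \<Sum>j=a..i - b. fls_nth (f x $$ (r,k)) j * fls_nth (E $$ (k,c)) (i - j)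
        + fls_nth (D $$ (r,k)) j * fls_nth (g x $$ (k,c)) (i - j))"
    using nth[OF D g(1) gD g(2)] nth[OF f(1) E f(2) gE] rc D E f(1) g(1)
    by (simp add: sq_mat_index[where N=N] sq_mat_closed[where N=N] sum.distrib del: index_mult_mat)
  ultimately show "((\<lambda>s. fls_nth ((f s * g s) $$ (r,c)) i) has_vector_derivative
      fls_nth ((D * g x + f x * E) $$ (r,c)) i) (at x)"
    by (simp only: nth[OF f(1) g(1) f(2) g(2)])
qed

lemma flm_deriv_minus:
  assumes c: "\<And>s. f s \<in> carrier_mat N N" "\<And>s. g s \<in> carrier_mat N N" "D \<in> carrier_mat N N" "E \<in> carrier_mat N N"
    and d: "flm_deriv N f D x" "flm_deriv N g E x"
  shows "flm_deriv N (\<lambda>s. f s - g s) (D - E) x"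
  unfolding flm_deriv_def
proof (intro allI impI)
  fix r k i assume rc: "r < N" "k < N"
  have "((\<lambda>s. fls_nth (f s $$ (r,k)) i - fls_nth (g s $$ (r,k)) i) has_vector_derivative
      fls_nth (D $$ (r,k)) i - fls_nth (E $$ (r,k)) i) (at x)"
    using d rc unfolding flm_deriv_def by (intro has_vector_derivative_diff) auto
  then show "((\<lambda>s. fls_nth ((f s - g s) $$ (r,k)) i) has_vector_derivative fls_nth ((D - E) $$ (r,k)) i) (at x)"
    by (simp only: sq_mat_index(2)[OF c(1,2) rc] sq_mat_index(2)[OF c(3,4) rc] fls_minus_nth)
qed

section \<open>Vanishing of the defect \<open>T K - K S\<close>\<close>

lemma flm_telescope:
  assumes S: "S \<in> carrier_mat N N" "flm_ge N (- 1) S" "flm_coeff N S (- 1) = J"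
    and T: "T \<in> carrier_mat N N" "flm_ge N (- 1) T" "flm_coeff N T (- 1) = J"
    and K: "K \<in> carrier_mat N N"
    and D: "flm_ge N a (T * K - K * S)"
    and comm: "flm_coeff N (T * K - K * S) a * J = J * flm_coeff N (T * K - K * S) a"
  shows "flm_ge N (a - int k) (T ^\<^sub>m Suc k * K - K * S ^\<^sub>m Suc k) \<and>
    flm_coeff N (T ^\<^sub>m Suc k * K - K * S ^\<^sub>m Suc k) (a - int k)
      = of_nat (Suc k) \<cdot>\<^sub>m (J ^\<^sub>m k * flm_coeff N (T * K - K * S) a)"
proof -
  define D where "D = T * K - K * S"
  define A where "A = flm_coeff N D a"
  note R = sq_mat_simps[where N=N]
  note [simp] = S(1) T(1) K
  have cD[simp]: "D \<in> carrier_mat N N" by (simp add: D_def R)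
  have cA[simp]: "A \<in> carrier_mat N N" by (simp add: A_def)
  have cJ[simp]: "J \<in> carrier_mat N N" using S(3) by auto
  have D': "flm_ge N a D" "A * J = J * A" using D comm by (simp_all add: D_def A_def)
  have "flm_ge N (a - int k) (T ^\<^sub>m Suc k * K - K * S ^\<^sub>m Suc k) \<and>
    flm_coeff N (T ^\<^sub>m Suc k * K - K * S ^\<^sub>m Suc k) (a - int k) = of_nat (Suc k) \<cdot>\<^sub>m (J ^\<^sub>m k * A)"
  proof (induction k)
    case 0
    have "J ^\<^sub>m 0 * A = A" using cJ by (simp add: carrier_matD[OF cJ] R)
    moreover have "of_nat (Suc 0) \<cdot>\<^sub>m A = A" using cA by (intro eq_matI) auto
    moreover have "T ^\<^sub>m Suc 0 = T" "S ^\<^sub>m Suc 0 = S"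
      by (simp_all add: carrier_matD[OF S(1)] carrier_matD[OF T(1)] R)
    ultimately show ?case
      using D'(1) by (simp add: A_def[symmetric] D_def[symmetric] del: pow_mat.simps of_nat_Suc)
  next
    case (Suc k)
    define Rk where "Rk = T ^\<^sub>m Suc k * K - K * S ^\<^sub>m Suc k"
    have cR[simp]: "Rk \<in> carrier_mat N N" unfolding Rk_def by (intro sq_mat_closed pow_mat_closed) simp_all
    have cT[simp]: "T ^\<^sub>m Suc k \<in> carrier_mat N N" and cS[simp]: "S ^\<^sub>m Suc k \<in> carrier_mat N N"
      by (intro pow_mat_closed, simp)+
    have cJk[simp]: "J ^\<^sub>m Suc k \<in> carrier_mat N N" "J ^\<^sub>m k \<in> carrier_mat N N"
      by (intro pow_mat_closed, simp)+
    \<comment> \<open>Iterated, this splitting writes the difference as the sum of the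
      \<open>T^i D S^(k-i)\<close>. All of them have leading coefficient \<open>J^k A\<close>,
      because \<open>A\<close> commutes with \<open>J\<close>; this explains the numerical
      factor.\<close>
    have split: "T ^\<^sub>m Suc (Suc k) * K - K * S ^\<^sub>m Suc (Suc k) = T ^\<^sub>m Suc k * D + Rk * S"
      unfolding pow_mat.simps(2)[of _ "Suc k"] Rk_def D_def
      by (rule sq_mat_eqI[of _ N]) (simp_all add: R del: index_mult_mat pow_mat.simps)
    have pT: "flm_ge N (- int (Suc k)) (T ^\<^sub>m Suc k)" "flm_coeff N (T ^\<^sub>m Suc k) (- int (Suc k)) = J ^\<^sub>m Suc k"
      using flm_pow[OF T(1,2), of "Suc k"] T(3) by (simp_all del: pow_mat.simps)
    have ix: "a - int (Suc k) = - int (Suc k) + a" "a - int (Suc k) = (a - int k) + - 1" by simp_all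
    note IH = Suc.IH[folded Rk_def]
    have m1: "flm_ge N (a - int (Suc k)) (T ^\<^sub>m Suc k * D)"
        "flm_coeff N (T ^\<^sub>m Suc k * D) (a - int (Suc k)) = J ^\<^sub>m Suc k * A"
      unfolding ix(1) using flm_mult[OF cT pT(1) cD D'(1)] pT(2) by (simp_all only: A_def)
    have m2: "flm_ge N (a - int (Suc k)) (Rk * S)"
        "flm_coeff N (Rk * S) (a - int (Suc k)) = (of_nat (Suc k) \<cdot>\<^sub>m (J ^\<^sub>m k * A)) * J"
      unfolding ix(2) using flm_mult[OF cR _ S(1,2)] IH S(3) by metis+
    have "(of_nat (Suc k) \<cdot>\<^sub>m (J ^\<^sub>m k * A)) * J = of_nat (Suc k) \<cdot>\<^sub>m (J ^\<^sub>m Suc k * A)"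
      by (simp add: R D'(2))
    then have "flm_coeff N (T ^\<^sub>m Suc k * D + Rk * S) (a - int (Suc k))
       = J ^\<^sub>m Suc k * A + of_nat (Suc k) \<cdot>\<^sub>m (J ^\<^sub>m Suc k * A)"
      using m1(2) m2(2) flm_coeff_add[of "T ^\<^sub>m Suc k * D" N "Rk * S"]
      by (simp add: R del: pow_mat.simps sq_mat_distrib(1) assoc_mult_mat)
    also have "\<dots> = of_nat (Suc (Suc k)) \<cdot>\<^sub>m (J ^\<^sub>m Suc k * A)"
      by (rule sq_mat_eqI[of _ N]) (simp_all add: R algebra_simps del: pow_mat.simps index_mult_mat)
    finally show ?case
      unfolding split using m1(1) m2(1) by (simp add: flm_ge_add R del: pow_mat.simps)
  qed
  then show ?thesis unfolding A_def D_def .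
qed

lemma intertwining_of_lax_solutions:
  fixes S T K M L :: "real \<Rightarrow> complex fls mat" and e :: nat
  assumes S: "\<And>x. S x \<in> carrier_mat N N" "\<And>x. flm_ge N (- 1) (S x)" "\<And>x. flm_coeff N (S x) (- 1) = J"
    and T: "\<And>x. T x \<in> carrier_mat N N" "\<And>x. flm_ge N (- 1) (T x)" "\<And>x. flm_coeff N (T x) (- 1) = J"
    and M: "\<And>x. M x \<in> carrier_mat N N" "\<And>x. flm_ge N (- 1) (M x)" "\<And>x. flm_coeff N (M x) (- 1) = J"
    and L: "\<And>x. L x \<in> carrier_mat N N" "\<And>x. flm_ge N (- 1) (L x)" "\<And>x. flm_coeff N (L x) (- 1) = J"
    and K: "\<And>x. K x \<in> carrier_mat N N" "\<And>x. flm_ge N b (K x)"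
    and dS: "\<And>x. flm_deriv N S (S x * M x - M x * S x) x"
    and dT: "\<And>x. flm_deriv N T (T x * L x - L x * T x) x"
    and dK: "\<And>x. flm_deriv N K (K x * M x - L x * K x) x"
    and e: "0 < e" and J: "J ^\<^sub>m Suc e = J"
    and Spow: "\<And>x. S x ^\<^sub>m Suc e = fls_shift (int e) 1 \<cdot>\<^sub>m S x"
    and Tpow: "\<And>x. T x ^\<^sub>m Suc e = fls_shift (int e) 1 \<cdot>\<^sub>m T x"
  shows "T x * K x = K x * S x"
proof -
  define D where "D x = T x * K x - K x * S x" for x
  note R = sq_mat_simps[where N=N]
  note [simp] = S(1) T(1) K(1) M(1) L(1)
  have cD[simp]: "D x \<in> carrier_mat N N" for x by (simp add: D_def R)
  have cJ[simp]: "J \<in> carrier_mat N N" using S(3)[of 0] by auto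
  \<comment> \<open>In the product rule the terms \<open>T L K\<close> and \<open>K M S\<close>
    cancel.\<close>
  have dD: "flm_deriv N D (D x * M x - L x * D x) x" for x
  proof -
    have "flm_deriv N (\<lambda>s. T s * K s - K s * S s)
      (((T x * L x - L x * T x) * K x + T x * (K x * M x - L x * K x))
        - ((K x * M x - L x * K x) * S x + K x * (S x * M x - M x * S x))) x"
      by (intro flm_deriv_minus[where N=N] flm_deriv_mult[where a="- 1" and b=b]
           flm_deriv_mult[where a=b and b="- 1"] S T K dS dT dK) (simp_all add: R)
    also have "((T x * L x - L x * T x) * K x + T x * (K x * M x - L x * K x))
        - ((K x * M x - L x * K x) * S x + K x * (S x * M x - M x * S x)) = D x * M x - L x * D x"
      unfolding D_def by (rule sq_mat_eqI[of _ N]) (simp_all add: R algebra_simps del: index_mult_mat)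
    finally show ?thesis unfolding D_def[abs_def] .
  qed
  have "\<forall>x. flm_ge N (b - 1 + int k) (D x)" for k
  proof (induction k)
    case 0
    have "flm_ge N (b - 1) (D x)" for x
      unfolding D_def using flm_mult(1)[OF T(1,2) K(1,2), of x x] flm_mult(1)[OF K(1,2) S(1,2), of x x]
      by (intro flm_ge_minus) (simp_all add: R algebra_simps)
    then show ?case by simp
  next
    case (Suc k)
    define a where "a = b - 1 + int k"
    have ge: "flm_ge N a (D x)" for x using Suc by (simp add: a_def)
    have "flm_coeff N (D x) a = 0\<^sub>m N N" for x
    proof -
      define A where "A = flm_coeff N (D x) a"
      have cA[simp]: "A \<in> carrier_mat N N" by (simp add: A_def)
      \<comment> \<open>\<open>D\<close> has order at least \<open>a\<close> at every parameter
        value, hence so has its derivative. But \<open>D M - L D\<close> could start one order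
        lower, with coefficient \<open>A J - J A\<close>, which must therefore vanish.\<close>
      have "flm_coeff N (D x * M x - L x * D x) (a - 1) = 0\<^sub>m N N"
        by (intro sq_mat_eqI[of _ N])
          (auto simp: flm_coeff_index intro!: flm_deriv_eq_0[OF dD] flm_geD[OF ge])
      moreover have "flm_coeff N (D x * M x) (a - 1) = A * J" "flm_coeff N (L x * D x) (a - 1) = J * A"
        using flm_mult(2)[OF cD ge M(1,2), of x x] flm_mult(2)[OF L(1,2) cD ge, of x x] M(3) L(3)
        by (simp_all add: A_def)
      ultimately have AJ: "A * J - J * A = 0\<^sub>m N N" by (simp add: flm_coeff_minus R)
      have comm: "A * J = J * A"
        by (rule sq_mat_minus_eq_0[OF _ _ AJ]) (simp_all add: R)
      have tel: "flm_coeff N (T x ^\<^sub>m Suc e * K x - K x * S x ^\<^sub>m Suc e) (a - int e)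
          = of_nat (Suc e) \<cdot>\<^sub>m (J ^\<^sub>m e * A)"
        using flm_telescope[OF S(1-3)[of x] T(1-3)[of x] K(1)[of x], of a e] ge comm unfolding A_def D_def by simp
      \<comment> \<open>By the power relations this difference is \<open>z^e D\<close>, so its
        coefficient at order \<open>a - e\<close> is \<open>A\<close>; \<open>tel\<close> evaluates
        the same coefficient.\<close>
      have "T x ^\<^sub>m Suc e * K x - K x * S x ^\<^sub>m Suc e = fls_shift (int e) 1 \<cdot>\<^sub>m D x"
        unfolding Spow Tpow D_def by (rule sq_mat_eqI[of _ N]) (simp_all add: R algebra_simps del: index_mult_mat)
      with tel have A: "A = of_nat (Suc e) \<cdot>\<^sub>m (J ^\<^sub>m e * A)"
        by (simp add: flm_smult_X A_def del: pow_mat.simps of_nat_Suc)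
      have cJe[simp]: "J ^\<^sub>m k \<in> carrier_mat N N" for k by simp
      \<comment> \<open>\<open>J\<close> may be singular, so \<open>A\<close> is removed in two
        stages: with \<open>J^(e+1) = J\<close> the equation for \<open>A\<close> becomes
        \<open>J A = (e+1) J A\<close>, hence \<open>J A = 0\<close>. Then \<open>J^e A = 0\<close>
        since \<open>e > 0\<close>, and the equation itself gives \<open>A = 0\<close>.\<close>
      have "A * J = of_nat (Suc e) \<cdot>\<^sub>m (J ^\<^sub>m e * (A * J))"
        by (subst A) (simp add: R)
      also have "J ^\<^sub>m e * (A * J) = J ^\<^sub>m Suc e * A" by (simp add: comm R)
      finally have eq: "J * A = of_nat (Suc e) \<cdot>\<^sub>m (J * A)" unfolding J comm .
      have JA: "J * A = 0\<^sub>m N N"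
      proof (rule sq_mat_eqI[of _ N])
        fix r c assume rc: "r < N" "c < N"
        have "(J * A) $$ (r,c) = of_nat (Suc e) * (J * A) $$ (r,c)"
          using arg_cong[OF eq, of "\<lambda>Z. Z $$ (r,c)"] rc by (simp add: R del: index_mult_mat of_nat_Suc)
        then have "of_nat e * (J * A) $$ (r,c) = 0" by (simp add: algebra_simps del: index_mult_mat)
        then show "(J * A) $$ (r,c) = 0\<^sub>m N N $$ (r,c)" using e rc by (simp del: index_mult_mat)
      qed (simp_all add: R)
      obtain e' where e': "e = Suc e'" using e by (cases e) auto
      have "J ^\<^sub>m e * A = 0\<^sub>m N N" unfolding e' by (simp add: R JA)
      with A have "A = of_nat (Suc e) \<cdot>\<^sub>m 0\<^sub>m N N" by simp
      then show ?thesis unfolding A_def by simp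
    qed
    then have "flm_ge N (a + 1) (D x)" for x using ge flm_ge_Suc by blast
    then show ?case by (simp add: a_def algebra_simps)
  qed
  \<comment> \<open>Truncation by \<open>nat\<close> is harmless: the order obtained is at least
    \<open>c\<close> in either case.\<close>
  then have "flm_ge N (b - 1 + int (nat (c - (b - 1)))) (D x)" for c by blast
  note high = this
  have "flm_ge N c (D x)" for c by (rule flm_ge_mono[OF high[of c]]) simp
  then have "D x = 0\<^sub>m N N" by (intro flm_eq_0) simp_all
  then show ?thesis
    unfolding D_def by (rule sq_mat_minus_eq_0[of _ N, rotated 2]) (simp_all add: R)
qed

section \<open>Carrying series data over to graded matrices\<close>

lemma graded_linear_nth:
  assumes "d > 0" "r < N" "c < N"
  shows "fls_nth (graded N d w (ser_linear N A1 A0) $$ (r,c)) i =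
    (if i + (w r - w c) = - int d then A1 $$ (r,c) else if i + (w r - w c) = 0 then A0 $$ (r,c) else 0)"
proof -
  define u where "u = i + (w r - w c)"
  have nth: "fls_nth (graded N d w (ser_linear N A1 A0) $$ (r,c)) i =
      (if int d dvd u then ser_linear N A1 A0 (- (u div int d)) $$ (r,c) else 0)"
    unfolding u_def by (rule graded_nth) (use assms in simp_all)
  show ?thesis
  proof (cases "int d dvd u")
    case True
    then obtain k where k: "u = int d * k" by blast
    then have "u = - int d \<longleftrightarrow> k = - 1" "u = 0 \<longleftrightarrow> k = 0" "u div int d = k"
      using assms(1) mult_cancel_left[of "int d" k "- 1"] by auto
    then show ?thesis unfolding nth u_def[symmetric]
      using True assms(2,3) by (auto simp: ser_linear_def simp del: div_mult_self1_is_m)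
  next
    case False
    then show ?thesis unfolding nth u_def[symmetric] by auto
  qed
qed

lemma ser_bdd_minus:
  assumes "ser_bdd N A" "ser_bdd N B"
  shows "ser_bdd N (\<lambda>k. A k - B k)"
proof -
  obtain a b where "\<And>k. k > a \<Longrightarrow> A k = 0\<^sub>m N N" "\<And>k. k > b \<Longrightarrow> B k = 0\<^sub>m N N"
    using assms unfolding ser_bdd_def by blast
  then show ?thesis unfolding ser_bdd_def by (intro exI[of _ "max a b"]) auto
qed

lemma graded_minus:
  assumes d: "d > 0" and A: "ser_bdd N A" "ser_carrier N A" and B: "ser_bdd N B" "ser_carrier N B"
  shows "graded N d w (\<lambda>k. A k - B k) = graded N d w A - graded N d w B"
proof (rule sq_mat_eqI[of _ N])
  fix r c assume rc: "r < N" "c < N"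
  show "graded N d w (\<lambda>k. A k - B k) $$ (r,c) = (graded N d w A - graded N d w B) $$ (r,c)"
    by (rule fls_eqI)
      (simp add: sq_mat_index[where N=N] rc graded_nth[OF d ser_bdd_minus[OF A(1) B(1)] rc]
        graded_nth[OF d A(1) rc] graded_nth[OF d B(1) rc] A(2) B(2) del: index_minus_mat)
qed (simp_all add: sq_mat_closed)

lemma graded_deriv:
  assumes d: "d > 0" and A: "\<And>s. ser_bdd N (A s)" and A': "ser_bdd N A'" "ser_carrier N A'"
    and D: "\<And>k. mat_deriv (\<lambda>s. A s k) (A' k) x"
  shows "flm_deriv N (\<lambda>s. graded N d w (A s)) (graded N d w A') x"
  unfolding flm_deriv_def
proof (intro allI impI)
  fix r c i assume rc: "r < N" "c < N"
  show "((\<lambda>s. fls_nth (graded N d w (A s) $$ (r,c)) i) has_vector_derivative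
      fls_nth (graded N d w A' $$ (r,c)) i) (at x)"
    using mat_derivD[OF D _ rc] A'(2)
    by (simp add: graded_nth[OF d A rc] graded_nth[OF d A'(1) rc])
qed

text \<open>\<open>S\<close> is the conjugate of \<open>H\<close> by \<open>G\<close>, expressed
  without an inverse. Multiplication by \<open>G\<close> on either side preserves leading
  coefficients, and \<open>S^i G = G H^i\<close> together with cancellation of \<open>G\<close>
  transfers the power relation.\<close>

lemma flm_conjugate:
  assumes S: "S \<in> carrier_mat N N" and G: "G \<in> carrier_mat N N" "flm_ge N 0 G" "flm_coeff N G 0 = 1\<^sub>m N"
    and H: "H \<in> carrier_mat N N" "flm_ge N (- 1) H" and Hpow: "H ^\<^sub>m p = k \<cdot>\<^sub>m H"
    and eq: "S * G = G * H"
  shows "flm_ge N (- 1) S" "flm_coeff N S (- 1) = flm_coeff N H (- 1)" "S ^\<^sub>m p = k \<cdot>\<^sub>m S"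
proof -
  note R = sq_mat_simps[where N=N]
  have lead: "flm_coeff N S b = flm_coeff N (G * H) b" if "flm_ge N b S" for b
    using flm_mult(2)[OF S that G(1,2)] G(3) eq by (simp add: R)
  have GH: "flm_ge N (- 1) (G * H)" "flm_coeff N (G * H) (- 1) = flm_coeff N H (- 1)"
    using flm_mult[OF G(1,2) H] G(3) by (simp_all add: R)
  obtain a where "flm_ge N a S" using flm_ge_exists by blast
  then show ge: "flm_ge N (- 1) S"
    by (rule flm_ge_induct) (simp add: lead flm_coeff_below[OF GH(1)])
  show "flm_coeff N S (- 1) = flm_coeff N H (- 1)" using lead[OF ge] GH(2) by simp
  have pow: "S ^\<^sub>m i * G = G * H ^\<^sub>m i" for i
  proof (induction i)
    case 0
    show ?case using S H G by (simp add: R)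
  next
    case (Suc i)
    have "S ^\<^sub>m Suc i * G = S ^\<^sub>m i * (S * G)" using S G by (simp add: R)
    also have "\<dots> = (S ^\<^sub>m i * G) * H" unfolding eq using S G H by (simp add: R)
    finally show ?case unfolding Suc using G H by (simp add: R)
  qed
  have "(S ^\<^sub>m p - k \<cdot>\<^sub>m S) * G = S ^\<^sub>m p * G - k \<cdot>\<^sub>m (S * G)"
    using S G by (simp add: R)
  also have "\<dots> = 0\<^sub>m N N" unfolding pow Hpow eq using S G H by (simp add: R)
  finally have "S ^\<^sub>m p - k \<cdot>\<^sub>m S = 0\<^sub>m N N"
    by (rule flm_right_cancel[OF _ G, rotated]) (use S in \<open>simp_all add: R\<close>)
  then show "S ^\<^sub>m p = k \<cdot>\<^sub>m S"
    by (rule sq_mat_minus_eq_0[rotated 2]) (use S in \<open>simp_all add: R\<close>)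
qed

lemma map_mat_fls_const_mult:
  assumes "A \<in> carrier_mat N N" "B \<in> carrier_mat N N"
  shows "map_mat fls_const (A * B) = map_mat fls_const A * (map_mat fls_const B :: complex fls mat)"
proof (rule sq_mat_eqI[of _ N])
  have sum: "fls_const (\<Sum>k<M. f k) = (\<Sum>k<M. fls_const (f k))" for f :: "nat \<Rightarrow> complex" and M
    by (induction M) (simp_all add: fls_plus_const[symmetric])
  fix r c assume rc: "r < N" "c < N"
  show "map_mat fls_const (A * B) $$ (r,c) = (map_mat fls_const A * map_mat fls_const B) $$ (r,c)"
    using assms rc by (simp add: sq_mat_mult_index[where N=N] sum fls_const_mult_const del: index_mult_mat(1))
qed (use assms in auto)

lemma sq_mat_smult_mult:
  fixes A B :: "'a::comm_ring_1 mat"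
  assumes "A \<in> carrier_mat N N" "B \<in> carrier_mat N N"
  shows "(a \<cdot>\<^sub>m A) * (b \<cdot>\<^sub>m B) = (a * b) \<cdot>\<^sub>m (A * B)"
proof -
  have "(a \<cdot>\<^sub>m A) * (b \<cdot>\<^sub>m B) = b \<cdot>\<^sub>m (a \<cdot>\<^sub>m (A * B))"
    using assms by (simp add: sq_mat_smult[where N=N] sq_mat_closed1[where N=N])
  then show ?thesis by (simp only:) (intro eq_matI; simp add: mult_ac del: index_mult_mat(1))
qed

lemma flm_pow_X_const:
  fixes A :: "complex mat"
  assumes A: "A \<in> carrier_mat N N"
  shows "(fls_shift 1 1 \<cdot>\<^sub>m map_mat fls_const A) ^\<^sub>m k = fls_shift (int k) 1 \<cdot>\<^sub>m map_mat fls_const (A ^\<^sub>m k)"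
proof (induction k)
  case 0
  show ?case using A by (intro eq_matI) auto
next
  case (Suc k)
  have "(fls_shift 1 1 \<cdot>\<^sub>m map_mat fls_const A) ^\<^sub>m Suc k
     = (fls_shift (int k) 1 * fls_shift 1 1) \<cdot>\<^sub>m (map_mat fls_const (A ^\<^sub>m k) * map_mat fls_const A)"
    unfolding pow_mat.simps(2) Suc by (rule sq_mat_smult_mult[of _ N]) (use A in simp_all)
  also have "\<dots> = fls_shift (int (Suc k)) 1 \<cdot>\<^sub>m map_mat fls_const (A ^\<^sub>m Suc k)"
    unfolding pow_mat.simps(2) map_mat_fls_const_mult[OF pow_mat_closed[OF A] A]
    by (simp only: fls_times_both_shifted_simp mult_1_left of_nat_Suc add.commute)
  finally show ?case .
qed

section \<open>The principal grading of the loop algebra\<close>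

text \<open>These weights make \<open>J(\<lambda>)\<close> homogeneous of degree 1 and every negative power of \<open>\<lambda>\<close> of negative
  degree, since the weights of two indices differ by at most \<open>2n\<close>.\<close>

definition weight :: "nat \<Rightarrow> nat \<Rightarrow> nat \<Rightarrow> int" where
  "weight m n r = (if r < 2 * m then 0 else int (r - 2 * m) - int n)"

abbreviation grade :: "nat \<Rightarrow> nat \<Rightarrow> mser \<Rightarrow> complex fls mat" where
  "grade m n \<equiv> graded (dimN m n) (Suc (2 * n)) (weight m n)"

lemma weight_bounds: "r < dimN m n \<Longrightarrow> - int n \<le> weight m n r \<and> weight m n r \<le> int n"
  by (auto simp: weight_def dimN_def)

lemma Emat_carrier [simp]: "Emat m n \<in> carrier_mat (dimN m n) (dimN m n)"
  and Bmat_carrier [simp]: "Bmat m n \<in> carrier_mat (dimN m n) (dimN m n)"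
  and Cmat_carrier [simp]: "Cmat m n \<in> carrier_mat (dimN m n) (dimN m n)"
  by (simp_all add: Emat_def Bmat_def Cmat_def)

lemma JQser_linear: "JQser m n Q = ser_linear (dimN m n) (Emat m n) (Bmat m n + Q)"
  by (auto simp: JQser_def ser_linear_def fun_eq_iff)

lemma Jser_linear: "Jser m n = ser_linear (dimN m n) (Emat m n) (Bmat m n)"
  by (auto simp: Jser_def ser_linear_def fun_eq_iff)

text \<open>This is \<open>J(1)\<close>: it permutes the last \<open>2n + 1\<close> basis vectors
  cyclically and kills the first \<open>2m\<close>.\<close>

definition cyclic_mat :: "nat \<Rightarrow> nat \<Rightarrow> complex mat" where
  "cyclic_mat m n = Emat m n + Bmat m n"

lemma cyclic_mat_carrier [simp]: "cyclic_mat m n \<in> carrier_mat (dimN m n) (dimN m n)"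
  by (simp add: cyclic_mat_def)

lemma cyclic_mat_index:
  assumes "r < dimN m n" "c < dimN m n"
  shows "cyclic_mat m n $$ (r,c)
    = (if 2 * m \<le> r \<and> 2 * m \<le> c \<and> r - 2 * m = (c - 2 * m + 1) mod (2 * n + 1) then 1 else 0)"
proof (cases "2 * m \<le> c")
  case True
  then obtain c' where c: "c = 2 * m + c'" using le_Suc_ex by blast
  then have c': "c' < 2 * n + 1" using assms by (simp add: dimN_def)
  show ?thesis
  proof (cases "c' = 2 * n")
    case True
    then show ?thesis using assms by (auto simp: cyclic_mat_def Emat_def Bmat_def dimN_def c)
  next
    case False
    then have "(c' + 1) mod (2 * n + 1) = c' + 1" using c' by simp
    then show ?thesis using assms False by (auto simp: cyclic_mat_def Emat_def Bmat_def dimN_def c)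
  qed
next
  case False
  then show ?thesis using assms by (auto simp: cyclic_mat_def Emat_def Bmat_def dimN_def)
qed

text \<open>A power of a cyclic shift is a longer shift. Exponents start at one because the zeroth
  power is also the identity on the first \<open>2m\<close> basis vectors.\<close>

lemma cyclic_mat_pow_index:
  assumes "r < dimN m n" "c < dimN m n"
  shows "(cyclic_mat m n ^\<^sub>m Suc k) $$ (r,c)
    = (if 2 * m \<le> r \<and> 2 * m \<le> c \<and> r - 2 * m = (c - 2 * m + Suc k) mod (2 * n + 1) then 1 else 0)"
  using assms
proof (induction k arbitrary: c)
  case 0
  have "cyclic_mat m n ^\<^sub>m Suc 0 = cyclic_mat m n"
    by (simp add: carrier_matD[OF cyclic_mat_carrier] sq_mat_unit[where N="dimN m n"])
  then show ?case using 0 by (simp add: cyclic_mat_index del: pow_mat.simps)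
next
  case (Suc k)
  define N where "N = dimN m n"
  \<comment> \<open>For \<open>c\<close> in the cyclic block, \<open>c1\<close> is the row of the
    only nonzero entry in column \<open>c\<close>.\<close>
  define c1 where "c1 = 2 * m + (c - 2 * m + 1) mod (2 * n + 1)"
  have c1: "c1 < N" unfolding c1_def N_def dimN_def
    using mod_less_divisor[of "2 * n + 1" "c - 2 * m + 1"] by linarith
  have "(cyclic_mat m n ^\<^sub>m Suc (Suc k)) $$ (r,c)
      = (\<Sum>s<N. (cyclic_mat m n ^\<^sub>m Suc k) $$ (r,s) * cyclic_mat m n $$ (s,c))"
    unfolding pow_mat.simps(2)[of _ "Suc k"] N_def
    by (rule sq_mat_mult_index) (use Suc.prems in \<open>simp_all add: pow_mat_closed del: pow_mat.simps\<close>)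
  also have "\<dots> = (\<Sum>s<N. if s = c1 then (if 2 * m \<le> c then (cyclic_mat m n ^\<^sub>m Suc k) $$ (r,c1) else 0) else 0)"
    using Suc.prems by (intro sum.cong refl) (auto simp: cyclic_mat_index N_def c1_def simp del: pow_mat.simps)
  also have "\<dots> = (if 2 * m \<le> c then (cyclic_mat m n ^\<^sub>m Suc k) $$ (r,c1) else 0)"
    using c1 by (simp del: pow_mat.simps)
  also have "\<dots> = (if 2 * m \<le> r \<and> 2 * m \<le> c \<and> r - 2 * m = (c1 - 2 * m + Suc k) mod (2 * n + 1) then 1 else 0)"
    using Suc.IH[of c1] Suc.prems c1 by (auto simp: N_def c1_def simp del: pow_mat.simps)
  also have "(c1 - 2 * m + Suc k) mod (2 * n + 1) = (c - 2 * m + Suc (Suc k)) mod (2 * n + 1)"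
    unfolding c1_def using mod_add_left_eq[of "c - 2 * m + 1" "2 * n + 1" "Suc k"] by simp
  finally show ?case .
qed

text \<open>The shift has period \<open>2n + 1\<close>; the extra factor accounts for the block on
  which the matrix is zero.\<close>

lemma cyclic_mat_pow: "cyclic_mat m n ^\<^sub>m Suc (2 * n + 1) = cyclic_mat m n"
proof (rule sq_mat_eqI[of _ "dimN m n"])
  fix r c assume rc: "r < dimN m n" "c < dimN m n"
  have "(c - 2 * m + Suc (2 * n + 1)) mod (2 * n + 1) = (c - 2 * m + 1) mod (2 * n + 1)"
    using mod_add_self2[of "c - 2 * m + 1" "2 * n + 1"] by (simp add: ac_simps)
  then show "(cyclic_mat m n ^\<^sub>m Suc (2 * n + 1)) $$ (r,c) = cyclic_mat m n $$ (r,c)"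
    unfolding cyclic_mat_pow_index[OF rc] cyclic_mat_index[OF rc] by simp
qed (rule pow_mat_closed, simp, simp)

text \<open>The entry of \<open>Emat\<close> has row weight \<open>-n\<close> and column weight
  \<open>n\<close>, so lambda times it has degree \<open>2n + 1 - 2n = 1\<close>; each entry of
  \<open>Bmat\<close> raises the weight by one.\<close>

lemma grade_Jser: "grade m n (Jser m n) = fls_shift 1 1 \<cdot>\<^sub>m map_mat fls_const (cyclic_mat m n)"
proof (rule sq_mat_eqI[of _ "dimN m n"])
  fix r c assume rc: "r < dimN m n" "c < dimN m n"
  show "grade m n (Jser m n) $$ (r,c) = (fls_shift 1 1 \<cdot>\<^sub>m map_mat fls_const (cyclic_mat m n)) $$ (r,c)"
  proof (rule fls_eqI)
    fix i
    have "fls_nth ((fls_shift 1 1 \<cdot>\<^sub>m map_mat fls_const (cyclic_mat m n)) $$ (r,c)) i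
        = (if i = - 1 then cyclic_mat m n $$ (r,c) else 0)"
      using rc by (auto simp: carrier_matD[OF cyclic_mat_carrier] fls_shifted_times_simps(2))
    moreover have "fls_nth (grade m n (Jser m n) $$ (r,c)) i = (if i = - 1 then cyclic_mat m n $$ (r,c) else 0)"
      unfolding Jser_linear using rc
      by (auto simp: graded_linear_nth cyclic_mat_def Emat_def Bmat_def weight_def dimN_def)
    ultimately show "fls_nth (grade m n (Jser m n) $$ (r,c)) i
       = fls_nth ((fls_shift 1 1 \<cdot>\<^sub>m map_mat fls_const (cyclic_mat m n)) $$ (r,c)) i" by simp
  qed
qed (simp_all add: sq_mat_closed1 map_carrier_mat)

text \<open>As a constant coefficient such a \<open>Q\<close> contributes no positive power of z, so
  adding it to \<open>J\<close> leaves the leading coefficient unchanged.\<close>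

definition nonpos_weight :: "nat \<Rightarrow> nat \<Rightarrow> complex mat \<Rightarrow> bool" where
  "nonpos_weight m n Q \<longleftrightarrow> (\<forall>r<dimN m n. \<forall>c<dimN m n. weight m n c < weight m n r \<longrightarrow> Q $$ (r,c) = 0)"

lemma grade_JQser:
  assumes Q: "Q \<in> carrier_mat (dimN m n) (dimN m n)" "nonpos_weight m n Q"
  shows "flm_ge (dimN m n) (- 1) (grade m n (JQser m n Q))"
    "flm_coeff (dimN m n) (grade m n (JQser m n Q)) (- 1) = cyclic_mat m n"
proof -
  have nth: "fls_nth (grade m n (JQser m n Q) $$ (r,c)) i
      = (if i = - 1 then cyclic_mat m n $$ (r,c) else 0)"
    if rc: "r < dimN m n" "c < dimN m n" and i: "i \<le> - 1" for r c i
  proof -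
    have "fls_nth (grade m n (JQser m n Q) $$ (r,c)) i
       = fls_nth (grade m n (Jser m n) $$ (r,c)) i + (if i + (weight m n r - weight m n c) = 0 then Q $$ (r,c) else 0)"
      unfolding JQser_linear Jser_linear using rc Q(1)
      by (simp add: graded_linear_nth sq_mat_index[where N="dimN m n"] del: index_add_mat)
    also have "(if i + (weight m n r - weight m n c) = 0 then Q $$ (r,c) else 0) = 0"
      using Q(2) rc i by (auto simp: nonpos_weight_def)
    also have "fls_nth (grade m n (Jser m n) $$ (r,c)) i = (if i = - 1 then cyclic_mat m n $$ (r,c) else 0)"
      unfolding grade_Jser using rc by (auto simp: carrier_matD[OF cyclic_mat_carrier] fls_shifted_times_simps(2))
    finally show ?thesis by simp
  qed
  show "flm_ge (dimN m n) (- 1) (grade m n (JQser m n Q))" by (simp add: flm_ge_def nth)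
  show "flm_coeff (dimN m n) (grade m n (JQser m n Q)) (- 1) = cyclic_mat m n"
    by (rule sq_mat_eqI[of _ "dimN m n"]) (simp_all add: flm_coeff_index nth)
qed

text \<open>\<open>Emat * A\<close> lives in row \<open>2m\<close>, which has the lowest weight, and
  \<open>A * Emat\<close> in the last column, which has the highest.\<close>

lemma nonpos_weight_comm_Emat:
  assumes A: "A \<in> carrier_mat (dimN m n) (dimN m n)"
  shows "nonpos_weight m n (mcomm (Emat m n) A)"
  unfolding nonpos_weight_def
proof (intro allI impI)
  define N where "N = dimN m n"
  fix r c assume rc: "r < dimN m n" "c < dimN m n" and w: "weight m n c < weight m n r"
  have r: "r \<noteq> 2 * m" using w weight_bounds[OF rc(2)] by (auto simp: weight_def)
  have c: "c \<noteq> N - 1" using w weight_bounds[OF rc(1)] by (auto simp: weight_def N_def dimN_def)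
  have "(Emat m n * A) $$ (r,c) = (\<Sum>k<N. Emat m n $$ (r,k) * A $$ (k,c))"
    unfolding N_def by (rule sq_mat_mult_index) (use A rc in simp_all)
  also have "\<dots> = 0" using r rc by (intro sum.neutral) (simp add: Emat_def N_def)
  finally have 1: "(Emat m n * A) $$ (r,c) = 0" .
  have "(A * Emat m n) $$ (r,c) = (\<Sum>k<N. A $$ (r,k) * Emat m n $$ (k,c))"
    unfolding N_def by (rule sq_mat_mult_index) (use A rc in simp_all)
  also have "\<dots> = 0" using c rc by (intro sum.neutral) (simp add: Emat_def N_def)
  finally have 2: "(A * Emat m n) $$ (r,c) = 0" .
  show "mcomm (Emat m n) A $$ (r,c) = 0"
    unfolding mcomm_def using 1 2 A rc by (simp add: sq_mat_simps[where N="dimN m n"] del: index_mult_mat index_minus_mat)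
qed

text \<open>As \<open>g\<close> starts at \<open>lambda^(-1)\<close>, the constant term of
  \<open>[J, g]\<close> is \<open>[Emat, g (-1)]\<close>.\<close>

lemma nonpos_weight_Ymn:
  assumes "Q \<in> Ymn m n"
  shows "nonpos_weight m n Q"
proof -
  define N where "N = dimN m n"
  note R = sq_mat_simps[where N=N]
  obtain g where g: "calG_minus m n g" and Q: "ser_plus N (ser_comm N (Jser m n) g) = (\<lambda>k. if k = 0 then Q else 0\<^sub>m N N)"
    using assms unfolding Ymn_def N_def by blast
  have cg: "ser_carrier N g" and g0: "g 0 = 0\<^sub>m N N" using g by (auto simp: calG_minus_def N_def)
  have [simp]: "Emat m n \<in> carrier_mat N N" "Bmat m n \<in> carrier_mat N N" by (simp_all add: N_def)
  have "Q = ser_comm N (Jser m n) g 0" using fun_cong[OF Q, of 0] by (simp add: ser_plus_def)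
  also have "\<dots> = mcomm (Emat m n) (g (- 1))"
    unfolding ser_comm_def Jser_linear N_def[symmetric] mcomm_def using cg
    by (simp add: ser_mult_linear_left ser_mult_linear_right g0 R)
  finally show ?thesis using nonpos_weight_comm_Emat[of "g (- 1)" m n] cg by (simp add: N_def)
qed

lemma nonpos_weight_add_smult:
  assumes "A \<in> carrier_mat (dimN m n) (dimN m n)" "B \<in> carrier_mat (dimN m n) (dimN m n)"
    and "nonpos_weight m n A" "nonpos_weight m n B"
  shows "nonpos_weight m n (A + k \<cdot>\<^sub>m B)"
  using assms by (auto simp: nonpos_weight_def sq_mat_simps[where N="dimN m n"] simp del: index_add_mat)

text \<open>A term with \<open>lambda^k\<close>, \<open>k < 0\<close>, has degree at most
  \<open>-(2n + 1) + 2n < 0\<close>, so only the identity coefficient reaches degree zero.\<close>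

lemma grade_G_minus:
  assumes g: "G_minus m n g"
  shows "flm_ge (dimN m n) 0 (grade m n g)" "flm_coeff (dimN m n) (grade m n g) 0 = 1\<^sub>m (dimN m n)"
    and "ser_bdd (dimN m n) g"
proof -
  define N where "N = dimN m n"
  have cg: "ser_carrier N g" and g0: "g 0 = 1\<^sub>m N" and gp: "\<And>k. k > 0 \<Longrightarrow> g k = 0\<^sub>m N N"
    using g by (auto simp: G_minus_def N_def)
  show b: "ser_bdd (dimN m n) g" using gp unfolding ser_bdd_def N_def by blast
  have nth: "fls_nth (grade m n g $$ (r,c)) i = (if i = 0 then 1\<^sub>m N $$ (r,c) else 0)"
    if rc: "r < N" "c < N" and i: "i \<le> 0" for r c i
  proof -
    define u where "u = i + (weight m n r - weight m n c)"
    have e: "fls_nth (grade m n g $$ (r,c)) i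
        = (if int (Suc (2 * n)) dvd u then g (- (u div int (Suc (2 * n)))) $$ (r,c) else 0)"
      unfolding u_def by (rule graded_nth) (use b rc in \<open>simp_all add: N_def\<close>)
    have u: "u \<le> 2 * int n" using weight_bounds[of r m n] weight_bounds[of c m n] i rc by (simp add: u_def N_def)
    show ?thesis
    proof (cases "int (Suc (2 * n)) dvd u")
      case True
      then obtain k where k: "u = int (Suc (2 * n)) * k" by blast
      then have q: "u div int (Suc (2 * n)) = k" by simp
      have "k \<le> 0"
      proof (rule ccontr)
        assume "\<not> k \<le> 0"
        then have "int (Suc (2 * n)) * 1 \<le> int (Suc (2 * n)) * k" by (intro mult_left_mono) auto
        then have "int (Suc (2 * n)) \<le> u" unfolding k by (simp only: mult_1_right)
        then show False using u by simp
      qed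
      show ?thesis
      proof (cases "k = 0")
        case True
        then have "i = weight m n c - weight m n r" using k by (simp add: u_def)
        then show ?thesis using e True k g0 rc i by auto
      next
        case False
        then have gk: "g (- k) = 0\<^sub>m N N" using \<open>k \<le> 0\<close> by (intro gp) simp
        have "i \<noteq> 0 \<or> r \<noteq> c" using False k by (auto simp: u_def)
        then show ?thesis using e True q gk rc by auto
      qed
    next
      case False
      then have "i \<noteq> 0 \<or> r \<noteq> c" by (auto simp: u_def)
      then show ?thesis using e False rc by auto
    qed
  qed
  show "flm_ge (dimN m n) 0 (grade m n g)" by (simp add: flm_ge_def nth[unfolded N_def])
  show "flm_coeff (dimN m n) (grade m n g) 0 = 1\<^sub>m (dimN m n)"
    by (rule sq_mat_eqI[of _ "dimN m n"]) (simp_all add: flm_coeff_index nth[unfolded N_def])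
qed

text \<open>The relation \<open>S g = g J\<close> hands the degree bound, the leading coefficient
  and the power relation of \<open>J\<close> to \<open>S\<close>. The last claim is the Lax
  equation, with its sign absorbed into the order of the products.\<close>

lemma grade_is_S:
  assumes S: "is_S m n q S" and q: "q x t \<in> carrier_mat (dimN m n) (dimN m n)"
  defines "Sh \<equiv> \<lambda>s. grade m n (S s t)" and "M \<equiv> grade m n (JQser m n (q x t))"
  shows "flm_ge (dimN m n) (- 1) (Sh x)" "flm_coeff (dimN m n) (Sh x) (- 1) = cyclic_mat m n"
    "Sh x ^\<^sub>m Suc (2 * n + 1) = fls_shift (int (2 * n + 1)) 1 \<cdot>\<^sub>m Sh x"
    "flm_deriv (dimN m n) Sh (Sh x * M - M * Sh x) x"
proof -
  define N where "N = dimN m n"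
  have b: "ser_bdd N (S s t)" and c: "ser_carrier N (S s t)" for s
    using S by (auto simp: is_S_def N_def)
  obtain g where g: "G_minus m n g" and eq: "ser_mult N (S x t) g = ser_mult N g (Jser m n)"
    using S unfolding is_S_def N_def by blast
  have cg: "ser_carrier N g" using g by (simp add: G_minus_def N_def)
  have bg: "ser_bdd N g" using grade_G_minus(3)[OF g] by (simp add: N_def)
  have J: "ser_bdd N (Jser m n)" "ser_carrier N (Jser m n)" by (simp_all add: Jser_linear N_def)
  define H where "H = fls_shift 1 1 \<cdot>\<^sub>m map_mat fls_const (cyclic_mat m n)"
  have cH: "H \<in> carrier_mat N N" by (simp add: H_def N_def sq_mat_closed1 map_carrier_mat)
  have "grade m n (ser_mult N (S x t) g) = Sh x * grade m n g"
    unfolding Sh_def N_def by (rule graded_mult) (use b c bg cg in \<open>simp_all add: N_def\<close>)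
  moreover have "grade m n (ser_mult N g (Jser m n)) = grade m n g * grade m n (Jser m n)"
    unfolding N_def by (rule graded_mult) (use J bg cg in \<open>simp_all add: N_def\<close>)
  ultimately have SG: "Sh x * grade m n g = grade m n g * H" using eq by (simp add: grade_Jser H_def)
  have Hnth: "fls_nth (H $$ (r,k)) i = (if i = - 1 then cyclic_mat m n $$ (r,k) else 0)"
    if "r < N" "k < N" for r k i
    unfolding H_def using that by (auto simp: N_def carrier_matD[OF cyclic_mat_carrier] fls_shifted_times_simps(2))
  have H1: "flm_ge N (- 1) H" by (simp add: flm_ge_def Hnth)
  have H2: "flm_coeff N H (- 1) = cyclic_mat m n"
    by (rule sq_mat_eqI[of _ N]) (simp_all add: flm_coeff_index Hnth N_def)
  \<comment> \<open>In terms of lambda this is \<open>J^(2n+2) = lambda J\<close>, as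
    \<open>lambda = z^(2n+1)\<close>.\<close>
  have H3: "H ^\<^sub>m Suc (2 * n + 1) = fls_shift (int (2 * n + 1)) 1 \<cdot>\<^sub>m H"
  proof -
    have "fls_shift (int (2 * n + 1)) 1 * (fls_shift 1 1 :: complex fls) = fls_shift (int (Suc (2 * n + 1))) 1"
      by (simp add: fls_times_both_shifted_simp add.commute)
    then have "fls_shift (int (2 * n + 1)) 1 \<cdot>\<^sub>m H
        = fls_shift (int (Suc (2 * n + 1))) 1 \<cdot>\<^sub>m map_mat fls_const (cyclic_mat m n)"
      unfolding H_def by (intro eq_matI) (simp_all add: mult.assoc[symmetric] del: of_nat_Suc of_nat_add)
    then show ?thesis
      unfolding H_def flm_pow_X_const[OF cyclic_mat_carrier] cyclic_mat_pow by simp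
  qed
  have cS: "Sh x \<in> carrier_mat N N" and cG: "grade m n g \<in> carrier_mat N N" by (simp_all add: Sh_def N_def)
  note conj = flm_conjugate[OF cS[unfolded N_def] cG[unfolded N_def] grade_G_minus(1,2)[OF g]
      cH[unfolded N_def] H1[unfolded N_def] H3 SG]
  show "flm_ge (dimN m n) (- 1) (Sh x)" by (rule conj(1))
  show "flm_coeff (dimN m n) (Sh x) (- 1) = cyclic_mat m n" using conj(2) H2 by (simp add: N_def)
  show "Sh x ^\<^sub>m Suc (2 * n + 1) = fls_shift (int (2 * n + 1)) 1 \<cdot>\<^sub>m Sh x" by (rule conj(3))
  define S' where "S' = (\<lambda>k. ser_mult N (S x t) (JQser m n (q x t)) k - ser_mult N (JQser m n (q x t)) (S x t) k)"
  have JQ: "ser_bdd N (JQser m n (q x t))" "ser_carrier N (JQser m n (q x t))"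
    using q by (simp_all add: JQser_linear N_def)
  have SM: "ser_bdd N (ser_mult N (S x t) (JQser m n (q x t)))" "ser_bdd N (ser_mult N (JQser m n (q x t)) (S x t))"
    by (intro ser_bdd_mult b JQ(1))+
  have bS': "ser_bdd N S'" unfolding S'_def by (rule ser_bdd_minus[OF SM])
  have gS': "graded N (Suc (2 * n)) (weight m n) S' = Sh x * M - M * Sh x"
    unfolding S'_def Sh_def M_def N_def[symmetric] using b c JQ SM
    by (simp add: graded_minus graded_mult)
  have "flm_deriv N (\<lambda>s. graded N (Suc (2 * n)) (weight m n) (S s t)) (graded N (Suc (2 * n)) (weight m n) S') x"
  proof (rule graded_deriv)
    fix k
    have "- ser_comm N (JQser m n (q x t)) (S x t) k = S' k"
      unfolding S'_def ser_comm_def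
      by (rule sq_mat_eqI[of _ N]) (simp_all add: sq_mat_simps[where N=N] del: index_minus_mat index_uminus_mat)
    then show "mat_deriv (\<lambda>s. S s t k) (S' k) x" using S unfolding is_S_def N_def by metis
  qed (use b bS' in \<open>simp_all add: S'_def sq_mat_closed\<close>)
  then show "flm_deriv (dimN m n) Sh (Sh x * M - M * Sh x) x"
    unfolding gS' by (simp add: Sh_def N_def)
qed

section \<open>The dressing factor intertwines the powers of the two series\<close>

lemma intertwining_pow:
  fixes S T K :: "'a::comm_ring_1 mat"
  assumes "S \<in> carrier_mat N N" "T \<in> carrier_mat N N" "K \<in> carrier_mat N N" "T * K = K * S"
  shows "T ^\<^sub>m k * K = K * S ^\<^sub>m k"
proof (induction k)
  case 0
  show ?case using assms by (simp add: sq_mat_unit[where N=N])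
next
  case (Suc k)
  have "T ^\<^sub>m Suc k * K = T ^\<^sub>m k * (T * K)" using assms by (simp add: sq_mat_distrib[where N=N])
  also have "\<dots> = (T ^\<^sub>m k * K) * S" unfolding assms(4) using assms by (simp add: sq_mat_distrib[where N=N])
  finally show ?case unfolding Suc using assms by (simp add: sq_mat_distrib[where N=N])
qed

text \<open>The conclusion is the coefficient of \<open>lambda^i\<close> in
  \<open>T^k K = K S^k\<close> for the dressing factor
  \<open>K = lambda + \<alpha> (1 - 2p)\<close>.\<close>

lemma darboux_intertwining:
  fixes m n :: nat and \<alpha> :: complex and q p :: "real \<Rightarrow> real \<Rightarrow> complex mat"
  defines "N \<equiv> dimN m n" and "qt \<equiv> \<lambda>x t. q x t + (2 * \<alpha>) \<cdot>\<^sub>m mcomm (Emat m n) (p x t)"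
  assumes S: "is_S m n q S" and T: "is_S m n qt T"
    and cq: "\<And>x. q x t \<in> carrier_mat N N" and nq: "\<And>x. nonpos_weight m n (q x t)"
    and cp: "\<And>x. p x t \<in> carrier_mat N N" and pp: "\<And>x. p x t * p x t = p x t"
    and dp: "\<And>x. mat_deriv (\<lambda>s. p s t)
       ((Jat m n \<alpha> + qt x t) * (1\<^sub>m N - p x t) - (1\<^sub>m N - p x t) * (Jat m n \<alpha> + q x t)) x"
  shows "ser_pow N (T x t) k (i - 1) + ser_pow N (T x t) k i * (\<alpha> \<cdot>\<^sub>m 1\<^sub>m N - (2 * \<alpha>) \<cdot>\<^sub>m p x t)
    = ser_pow N (S x t) k (i - 1) + (\<alpha> \<cdot>\<^sub>m 1\<^sub>m N - (2 * \<alpha>) \<cdot>\<^sub>m p x t) * ser_pow N (S x t) k i"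
proof -
  let ?G = "graded N (Suc (2 * n)) (weight m n)"
  note R = sq_mat_simps[where N=N]
  define E B where "E = Emat m n" and "B = Bmat m n"
  have cE[simp]: "E \<in> carrier_mat N N" and cB[simp]: "B \<in> carrier_mat N N" by (simp_all add: E_def B_def N_def)
  note [simp] = cq cp
  have cqt[simp]: "qt x t \<in> carrier_mat N N" for x by (simp add: qt_def mcomm_def R E_def[symmetric])
  have nqt: "nonpos_weight m n (qt x t)" for x
    unfolding qt_def by (rule nonpos_weight_add_smult)
      (use cq cp nq nonpos_weight_comm_Emat in \<open>simp_all add: N_def mcomm_def sq_mat_closed\<close>)
  define eps where "eps x = \<alpha> \<cdot>\<^sub>m 1\<^sub>m N - (2 * \<alpha>) \<cdot>\<^sub>m p x t" for x
  have ceps[simp]: "eps x \<in> carrier_mat N N" for x by (simp add: eps_def R)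
  define K where "K x = ser_linear N (1\<^sub>m N) (eps x)" for x
  have bK[simp]: "ser_bdd N (K x)" and cK: "ser_carrier N (K x)" for x by (simp_all add: K_def)
  define D where "D x = (Jat m n \<alpha> + qt x t) * (1\<^sub>m N - p x t) - (1\<^sub>m N - p x t) * (Jat m n \<alpha> + q x t)" for x
  have J: "Jat m n \<alpha> = \<alpha> \<cdot>\<^sub>m E + B" by (simp add: Jat_def E_def B_def)
  have cD[simp]: "D x \<in> carrier_mat N N" for x by (simp add: D_def J R)
  have JQ: "JQser m n (q x t) = ser_linear N E (B + q x t)" "JQser m n (qt x t) = ser_linear N E (B + qt x t)" for x
    by (simp_all add: JQser_linear E_def B_def N_def)
  have bJQ: "ser_bdd N (JQser m n (q x t))" "ser_bdd N (JQser m n (qt x t))"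
    and cJQ: "ser_carrier N (JQser m n (q x t))" "ser_carrier N (JQser m n (qt x t))" for x
    by (simp_all add: JQ R)
  define K' where "K' x = (\<lambda>k. ser_mult N (K x) (JQser m n (q x t)) k - ser_mult N (JQser m n (qt x t)) (K x) k)" for x
  \<comment> \<open>In \<open>K (J + q) - (J + qt) K\<close> the coefficient of
    \<open>lambda^2\<close> is \<open>E - E\<close>, and that of lambda cancels by the choice of
    \<open>qt\<close>. What remains is \<open>-2 \<alpha> D\<close>, the derivative of
    \<open>K\<close>, since \<open>D\<close> is the derivative of \<open>p\<close> by
    \<open>dp\<close>.\<close>
  have K': "K' x k = ser_linear N (0\<^sub>m N N) (- (2 * \<alpha>) \<cdot>\<^sub>m D x) k" for x k
  proof -
    have K'k: "K' x k = K x (k - 1) * E + K x k * (B + q x t) - (E * K x (k - 1) + (B + qt x t) * K x k)"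
      unfolding K'_def JQ using cK by (simp add: ser_mult_linear_left ser_mult_linear_right R)
    have qt: "qt x t = q x t + (2 * \<alpha>) \<cdot>\<^sub>m (E * p x t - p x t * E)"
      by (simp add: qt_def mcomm_def E_def)
    consider "k = 2" | "k = 1" | "k = 0" | "k \<noteq> 2" "k \<noteq> 1" "k \<noteq> 0" by blast
    then show ?thesis
    proof cases
      case 1
      then show ?thesis unfolding K'k by (simp add: K_def ser_linear_def R)
    next
      case 2
      show ?thesis unfolding K'k unfolding 2 qt
        by (rule sq_mat_eqI[of _ N])
          (simp_all add: K_def ser_linear_def eps_def R algebra_simps del: index_mult_mat index_add_mat index_minus_mat)
    next
      case 3
      \<comment> \<open>Words are right-associated by the rewriting, so idempotence is also needed
        in front of a further factor.\<close>
      have ppX: "p x t * (p x t * X) = p x t * X" if "X \<in> carrier_mat N N" for X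
        using pp[of x] that sq_mat_distrib(1)[of "p x t" N "p x t" X] by simp
      show ?thesis unfolding K'k unfolding 3 D_def J qt
        by (rule sq_mat_eqI[of _ N])
          (simp_all add: K_def ser_linear_def eps_def R pp ppX algebra_simps del: index_mult_mat index_add_mat index_minus_mat)
    next
      case 4
      then show ?thesis unfolding K'k by (simp add: K_def ser_linear_def R)
    qed
  qed
  have cK': "ser_carrier N (K' x)" for x by (simp add: K'_def R)
  have bKM: "ser_bdd N (ser_mult N (K x) (JQser m n (q x t)))" "ser_bdd N (ser_mult N (JQser m n (qt x t)) (K x))" for x
    by (intro ser_bdd_mult bK bJQ)+
  have bK': "ser_bdd N (K' x)" for x
    unfolding K'_def by (intro ser_bdd_minus bKM)
  have gK': "?G (K' x) = ?G (K x) * ?G (JQser m n (q x t))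
      - ?G (JQser m n (qt x t)) * ?G (K x)" for x
    unfolding K'_def using bKM cK bJQ cJQ by (simp add: graded_minus graded_mult)
  have dKk: "mat_deriv (\<lambda>s. K s k) (K' x k) x" for x k
  proof (rule mat_derivI[of _ N])
    fix r c assume rc: "r < N" "c < N"
    show "((\<lambda>s. K s k $$ (r,c)) has_vector_derivative K' x k $$ (r,c)) (at x)"
    proof (cases "k = 0")
      case True
      have "((\<lambda>s. \<alpha> * 1\<^sub>m N $$ (r,c) - (2 * \<alpha>) * p s t $$ (r,c)) has_vector_derivative
          0 - (2 * \<alpha>) * D x $$ (r,c)) (at x)"
        by (intro has_vector_derivative_diff has_vector_derivative_const has_vector_derivative_mult_right
          mat_derivD[OF dp[folded D_def] cD rc])
      then show ?thesis using rc
        by (simp add: True K' K_def ser_linear_def eps_def R del: index_one_mat)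
    qed (use rc in \<open>simp add: K' K_def ser_linear_def\<close>)
  qed (simp add: cK')
  have dK: "flm_deriv N (\<lambda>s. ?G (K s)) (?G (K x) * ?G (JQser m n (q x t))
      - ?G (JQser m n (qt x t)) * ?G (K x)) x" for x
    using graded_deriv[OF _ bK bK' cK' dKk, of "Suc (2 * n)" "weight m n" x]
    unfolding gK' by simp
  \<comment> \<open>Any bound uniform in \<open>x\<close> will do: lambda has degree
    \<open>2n + 1\<close>, and the weights add at most \<open>2n\<close>.\<close>
  have geK: "flm_ge N (- int (Suc (2 * n)) - 2 * int n) (?G (K x))" for x
    unfolding flm_ge_def
  proof (intro allI impI)
    fix r c i assume rc: "r < N" "c < N" and i: "i < - int (Suc (2 * n)) - 2 * int n"
    have "i + (weight m n r - weight m n c) < - int (Suc (2 * n))"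
      using weight_bounds[of r m n] weight_bounds[of c m n] rc i by (simp add: N_def)
    then show "fls_nth (?G (K x) $$ (r,c)) i = 0"
      unfolding K_def using rc by (subst graded_linear_nth) simp_all
  qed
  have cyc: "cyclic_mat m n ^\<^sub>m Suc (2 * n + 1) = cyclic_mat m n" by (rule cyclic_mat_pow)
  have TK: "?G (T x t) * ?G (K x) = ?G (K x) * ?G (S x t)"
    by (rule intertwining_of_lax_solutions[where N=N and J="cyclic_mat m n" and e="2 * n + 1"
          and M="\<lambda>x. ?G (JQser m n (q x t))" and L="\<lambda>x. ?G (JQser m n (qt x t))"
          and S="\<lambda>x. ?G (S x t)" and T="\<lambda>x. ?G (T x t)" and K="\<lambda>x. ?G (K x)", OF
          _ grade_is_S(1,2)[OF S cq[unfolded N_def], folded N_def]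
          _ grade_is_S(1,2)[OF T cqt[unfolded N_def], folded N_def]
          _ grade_JQser[OF cq[unfolded N_def] nq, folded N_def]
          _ grade_JQser[OF cqt[unfolded N_def] nqt, folded N_def]
          _ geK
          grade_is_S(4)[OF S cq[unfolded N_def], folded N_def]
          grade_is_S(4)[OF T cqt[unfolded N_def], folded N_def]
          dK _ cyc
          grade_is_S(3)[OF S cq[unfolded N_def], folded N_def]
          grade_is_S(3)[OF T cqt[unfolded N_def], folded N_def]])
      simp_all
  have bS: "ser_bdd N (S x t)" "ser_carrier N (S x t)" and bT: "ser_bdd N (T x t)" "ser_carrier N (T x t)"
    using S T by (auto simp: is_S_def N_def)
  \<comment> \<open>Powers are taken on the graded side; \<open>graded_inject\<close> then brings
    the identity back to series.\<close>
  have "?G (ser_mult N (ser_pow N (T x t) k) (K x))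
      = ?G (ser_mult N (K x) (ser_pow N (S x t) k))"
    using bS bT cK intertwining_pow[OF _ _ _ TK, of N k]
    by (simp add: graded_mult graded_pow ser_bdd_pow)
  then have "ser_mult N (ser_pow N (T x t) k) (K x) = ser_mult N (K x) (ser_pow N (S x t) k)"
    by (rule graded_inject[rotated 5]) (use bS bT cK in \<open>simp_all add: ser_bdd_mult ser_bdd_pow\<close>)
  from fun_cong[OF this, of i] show ?thesis
    unfolding K_def by (simp add: ser_mult_linear_left ser_mult_linear_right R eps_def)
qed

section \<open>Polynomial parts of intertwined series\<close>

text \<open>The fixed range of summation, independent of the support of \<open>W\<close>, permits
  induction on \<open>M\<close>.\<close>

definition partial_eval :: "nat \<Rightarrow> nat \<Rightarrow> mser \<Rightarrow> complex \<Rightarrow> complex mat" where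
  "partial_eval N M W l = mat N N (\<lambda>(r,c). \<Sum>i<M. l ^ i * W (int i) $$ (r,c))"

lemma partial_eval_carrier [simp]: "partial_eval N M W l \<in> carrier_mat N N"
  by (simp add: partial_eval_def)

lemma ser_plus_eval_carrier [simp]: "ser_plus_eval N W l \<in> carrier_mat N N"
  by (simp add: ser_plus_eval_def)

lemma ser_plus_eval_partial:
  assumes "\<And>i. i \<ge> int M \<Longrightarrow> W i = 0\<^sub>m N N"
  shows "ser_plus_eval N W l = partial_eval N M W l"
proof (rule sq_mat_eqI[of _ N])
  fix r c assume rc: "r < N" "c < N"
  have "(\<Sum>i\<in>{i. 0 \<le> i \<and> W i \<noteq> 0\<^sub>m N N}. l ^ nat i * W i $$ (r,c))
      = (\<Sum>i\<in>{0..<int M}. l ^ nat i * W i $$ (r,c))"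
    using assms rc by (intro sum.mono_neutral_left) (auto simp: not_le intro: ccontr)
  also have "\<dots> = (\<Sum>i<M. l ^ i * W (int i) $$ (r,c))"
    by (rule sum.reindex_bij_witness[of _ int nat]) auto
  finally show "ser_plus_eval N W l $$ (r,c) = partial_eval N M W l $$ (r,c)"
    using rc by (simp add: ser_plus_eval_def partial_eval_def)
qed simp_all

lemma partial_eval_Suc:
  assumes "ser_carrier N W"
  shows "partial_eval N (Suc M) W l = partial_eval N M W l + l ^ M \<cdot>\<^sub>m W (int M)"
  using assms by (intro sq_mat_eqI[of _ N]) (simp_all add: sq_mat_simps[where N=N] partial_eval_def)

text \<open>Put \<open>c_i = V i * X - X * W i\<close>. The relation says
  \<open>V i - W i = - c_(i+1)\<close>, so the left-hand side is the telescoping sum of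
  \<open>l^i c_i - l^(i+1) c_(i+1)\<close> over \<open>i < M\<close>.\<close>

lemma partial_eval_intertwined:
  assumes W: "ser_carrier N W" and V: "ser_carrier N V" and X: "X \<in> carrier_mat N N"
    and rel: "\<And>i. V (i - 1) + V i * X = W (i - 1) + X * W i"
  shows "partial_eval N M V l * (l \<cdot>\<^sub>m 1\<^sub>m N + X) - (l \<cdot>\<^sub>m 1\<^sub>m N + X) * partial_eval N M W l
    = (V 0 * X - X * W 0) - l ^ M \<cdot>\<^sub>m (V (int M) * X - X * W (int M))"
proof (induction M)
  case 0
  have "partial_eval N 0 Z l = 0\<^sub>m N N" for Z by (intro eq_matI) (auto simp: partial_eval_def)
  then show ?case using W V X
    by (intro sq_mat_eqI[of _ N]) (simp_all add: sq_mat_simps[where N=N] del: index_mult_mat)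
next
  case (Suc M)
  note [simp] = W[rule_format] V[rule_format] X
  note R = sq_mat_simps[where N=N]
  show ?case
  proof (rule sq_mat_eqI[of _ N])
    fix r c assume rc: "r < N" "c < N"
    have step: "V (int M) $$ (r,c) = W (int M) $$ (r,c) - ((V (int (Suc M)) * X) $$ (r,c) - (X * W (int (Suc M))) $$ (r,c))"
      using arg_cong[OF rel[of "int (Suc M)"], of "\<lambda>Z. Z $$ (r,c)"] rc
      by (simp add: R algebra_simps del: index_mult_mat)
    have Vrc: "l * (l ^ M * V (int M) $$ (r,c)) = l * (l ^ M * W (int M) $$ (r,c))
       - l ^ Suc M * ((V (int (Suc M)) * X) $$ (r,c) - (X * W (int (Suc M))) $$ (r,c))"
      unfolding step by (simp only: power_Suc right_diff_distrib mult.assoc)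
    show "(partial_eval N (Suc M) V l * (l \<cdot>\<^sub>m 1\<^sub>m N + X) - (l \<cdot>\<^sub>m 1\<^sub>m N + X) * partial_eval N (Suc M) W l) $$ (r,c)
      = ((V 0 * X - X * W 0) - l ^ Suc M \<cdot>\<^sub>m (V (int (Suc M)) * X - X * W (int (Suc M)))) $$ (r,c)"
      using arg_cong2[where f="(+)", OF arg_cong[OF Suc.IH, of "\<lambda>Z. Z $$ (r,c)"] Vrc] rc
      by (simp add: partial_eval_Suc[OF W] partial_eval_Suc[OF V] R algebra_simps del: index_mult_mat of_nat_Suc power_Suc)
  qed (simp_all add: R)
qed

text \<open>The right-hand side does not depend on \<open>l\<close>, so the values at \<open>\<alpha>\<close> and \<open>-\<alpha>\<close> can be compared.\<close>

lemma ser_plus_eval_intertwined: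
  assumes W: "ser_carrier N W" "ser_bdd N W" and V: "ser_carrier N V" "ser_bdd N V"
    and X: "X \<in> carrier_mat N N"
    and rel: "\<And>i. V (i - 1) + V i * X = W (i - 1) + X * W i"
  shows "ser_plus_eval N V l * (l \<cdot>\<^sub>m 1\<^sub>m N + X) - (l \<cdot>\<^sub>m 1\<^sub>m N + X) * ser_plus_eval N W l = V 0 * X - X * W 0"
proof -
  obtain a b where a: "\<And>i. i > a \<Longrightarrow> V i = 0\<^sub>m N N" and b: "\<And>i. i > b \<Longrightarrow> W i = 0\<^sub>m N N"
    using W(2) V(2) unfolding ser_bdd_def by blast
  \<comment> \<open>\<open>M\<close> lies beyond both supports, so the boundary term at
    \<open>M\<close> vanishes.\<close>
  define M where "M = nat (max a b + 1)"
  have VM: "V i = 0\<^sub>m N N" and WM: "W i = 0\<^sub>m N N" if "i \<ge> int M" for i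
  proof -
    have "max a b + 1 \<le> i" using that unfolding M_def by linarith
    then show "V i = 0\<^sub>m N N" "W i = 0\<^sub>m N N" using a[of i] b[of i] by auto
  qed
  have e: "ser_plus_eval N V l = partial_eval N M V l" "ser_plus_eval N W l = partial_eval N M W l"
    by (rule ser_plus_eval_partial, erule VM WM)+
  have "ser_plus_eval N V l * (l \<cdot>\<^sub>m 1\<^sub>m N + X) - (l \<cdot>\<^sub>m 1\<^sub>m N + X) * ser_plus_eval N W l
    = (V 0 * X - X * W 0) - l ^ M \<cdot>\<^sub>m (V (int M) * X - X * W (int M))"
    unfolding e
    by (rule partial_eval_intertwined[OF W(1) V(1) X rel])
  also have "\<dots> = V 0 * X - X * W 0"
    unfolding VM[OF order_refl] WM[OF order_refl] using W(1) V(1) X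
    by (intro sq_mat_eqI[of _ N]) (simp_all add: sq_mat_simps[where N=N] del: index_mult_mat)
  finally show ?thesis .
qed

lemma ser_plus_eval_darboux:
  fixes p :: "complex mat"
  assumes W: "ser_carrier N W" "ser_bdd N W" and V: "ser_carrier N V" "ser_bdd N V"
    and p: "p \<in> carrier_mat N N" "p * p = p" and \<alpha>: "\<alpha> \<noteq> 0"
    and rel: "\<And>i. V (i - 1) + V i * (\<alpha> \<cdot>\<^sub>m 1\<^sub>m N - (2 * \<alpha>) \<cdot>\<^sub>m p) = W (i - 1) + (\<alpha> \<cdot>\<^sub>m 1\<^sub>m N - (2 * \<alpha>) \<cdot>\<^sub>m p) * W i"
  shows "ser_plus_eval N V \<alpha> * (1\<^sub>m N - p) - (1\<^sub>m N - p) * ser_plus_eval N W \<alpha>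
    = p * ser_plus_eval N W (- \<alpha>) * (1\<^sub>m N - p) - (1\<^sub>m N - p) * ser_plus_eval N W \<alpha> * p"
proof -
  note R = sq_mat_simps[where N=N]
  define X where "X = \<alpha> \<cdot>\<^sub>m 1\<^sub>m N - (2 * \<alpha>) \<cdot>\<^sub>m p"
  define C where "C = V 0 * X - X * W 0"
  define V1 V2 W1 W2 where "V1 = ser_plus_eval N V \<alpha>" and "V2 = ser_plus_eval N V (- \<alpha>)"
    and "W1 = ser_plus_eval N W \<alpha>" and "W2 = ser_plus_eval N W (- \<alpha>)"
  define Q where "Q = 1\<^sub>m N - p"
  note [simp] = p(1)
  have [simp]: "X \<in> carrier_mat N N" "V1 \<in> carrier_mat N N" "V2 \<in> carrier_mat N N" "W1 \<in> carrier_mat N N"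
      "W2 \<in> carrier_mat N N" "Q \<in> carrier_mat N N"
    by (simp_all add: X_def V1_def V2_def W1_def W2_def Q_def R)
  have [simp]: "C \<in> carrier_mat N N" using W(1) V(1) by (simp add: C_def R)
  note ev = ser_plus_eval_intertwined[OF W V _ rel, folded X_def C_def]
  \<comment> \<open>At the points \<open>\<alpha>\<close> and \<open>-\<alpha>\<close> the dressing
    factor degenerates to multiples of the complementary projections.\<close>
  have XQ: "\<alpha> \<cdot>\<^sub>m 1\<^sub>m N + X = (2 * \<alpha>) \<cdot>\<^sub>m Q"
    by (rule sq_mat_eqI[of _ N]) (simp_all add: X_def Q_def R algebra_simps del: index_one_mat)
  have Xp: "(- \<alpha>) \<cdot>\<^sub>m 1\<^sub>m N + X = (- 2 * \<alpha>) \<cdot>\<^sub>m p"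
    by (rule sq_mat_eqI[of _ N]) (simp_all add: X_def R algebra_simps del: index_one_mat)
  have e1: "V1 * ((2 * \<alpha>) \<cdot>\<^sub>m Q) - ((2 * \<alpha>) \<cdot>\<^sub>m Q) * W1 = C"
    using ev[of \<alpha>] by (simp add: V1_def W1_def XQ)
  have e2: "V2 * ((- 2 * \<alpha>) \<cdot>\<^sub>m p) - ((- 2 * \<alpha>) \<cdot>\<^sub>m p) * W2 = C"
    using ev[of "- \<alpha>"] by (simp add: V2_def W2_def Xp)
  have Y: "V1 * Q - Q * W1 = p * W2 - V2 * p"
  proof (rule sq_mat_eqI[of _ N])
    fix r c assume rc: "r < N" "c < N"
    have "2 * \<alpha> * ((V1 * Q) $$ (r,c) - (Q * W1) $$ (r,c)) = C $$ (r,c)"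
      using arg_cong[OF e1, of "\<lambda>Z. Z $$ (r,c)"] rc by (simp add: R algebra_simps del: index_mult_mat)
    moreover have "2 * \<alpha> * ((p * W2) $$ (r,c) - (V2 * p) $$ (r,c)) = C $$ (r,c)"
      using arg_cong[OF e2, of "\<lambda>Z. Z $$ (r,c)"] rc by (simp add: R algebra_simps del: index_mult_mat)
    ultimately have "2 * \<alpha> * ((V1 * Q) $$ (r,c) - (Q * W1) $$ (r,c)) = 2 * \<alpha> * ((p * W2) $$ (r,c) - (V2 * p) $$ (r,c))"
      by simp
    then show "(V1 * Q - Q * W1) $$ (r,c) = (p * W2 - V2 * p) $$ (r,c)"
      using \<alpha> rc by (simp add: R del: index_mult_mat)
  qed (simp_all add: R)
  have QQ: "Q * Q = Q" and Qp: "Q * p = 0\<^sub>m N N" and pQ: "p * Q = 0\<^sub>m N N"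
    by (rule sq_mat_eqI[of _ N]; simp add: Q_def R p(2) del: index_mult_mat)+
  \<comment> \<open>Multiplying by \<open>Q\<close> on the right removes \<open>V2\<close>,
    multiplying by \<open>p\<close> removes \<open>V1\<close>; the two products add up because
    \<open>Q + p = 1\<close>.\<close>
  have "(V1 * Q - Q * W1) * Q = p * W2 * Q"
    unfolding Y by (rule sq_mat_eqI[of _ N]) (simp_all add: R pQ del: index_mult_mat)
  moreover have "(V1 * Q - Q * W1) * p = - (Q * W1 * p)"
    by (rule sq_mat_eqI[of _ N]) (simp_all add: R Qp del: index_mult_mat)
  moreover have "V1 * Q - Q * W1 = (V1 * Q - Q * W1) * Q + (V1 * Q - Q * W1) * p"
    by (rule sq_mat_eqI[of _ N]) (simp_all add: R QQ Qp, simp add: Q_def R del: index_mult_mat)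
  ultimately have "V1 * Q - Q * W1 = p * W2 * Q + - (Q * W1 * p)" by simp
  also have "\<dots> = p * W2 * Q - Q * W1 * p"
    by (rule sq_mat_eqI[of _ N]) (simp_all add: R del: index_mult_mat)
  finally show ?thesis unfolding V1_def W1_def W2_def Q_def .
qed

section \<open>The moving projection\<close>

lemma mat_eq_of_mult_vec:
  fixes A B :: "complex mat"
  assumes A: "A \<in> carrier_mat N N" and B: "B \<in> carrier_mat N N"
    and eq: "\<And>v. v \<in> carrier_vec N \<Longrightarrow> A *\<^sub>v v = B *\<^sub>v v"
  shows "A = B"
proof (rule sq_mat_eqI[OF A B])
  fix r c assume rc: "r < N" "c < N"
  have "(Z *\<^sub>v unit_vec N c) $ r = Z $$ (r,c)" if "Z \<in> carrier_mat N N" for Z :: "complex mat"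
    using that rc by simp
  then show "A $$ (r,c) = B $$ (r,c)" using eq[of "unit_vec N c"] A B by (metis unit_vec_carrier)
qed

text \<open>Here \<open>f\<close> and \<open>g\<close> stand for the frame at
  \<open>\<alpha>\<close> and \<open>-\<alpha>\<close>. Since \<open>C * C = 1\<close>, the reality
  condition exhibits their inverses \<open>fi\<close> and \<open>gi\<close>. The last four
  conclusions express that \<open>p\<close> has image \<open>f^-1 (Im P)\<close> and kernel
  \<open>g^-1 (ker P)\<close>.\<close>

lemma frame_projection:
  fixes f g p P C :: "complex mat"
  assumes c: "f \<in> carrier_mat N N" "g \<in> carrier_mat N N" "p \<in> carrier_mat N N" "P \<in> carrier_mat N N" "C \<in> carrier_mat N N"
    and C: "C * C = 1\<^sub>m N" "C\<^sup>T = C" and frame: "f * C * g\<^sup>T = C"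
    and P: "P * P = P" "C * P = P\<^sup>T * C" and p: "p * p = p" "C * p = p\<^sup>T * C"
    and im: "mat_image N p = preimage_space N f (mat_image N P)"
  defines "fi \<equiv> C * g\<^sup>T * C" and "gi \<equiv> C * f\<^sup>T * C"
  shows "f * fi = 1\<^sub>m N" "fi * f = 1\<^sub>m N" "g * gi = 1\<^sub>m N" "gi * g = 1\<^sub>m N"
    "p * (fi * P) = fi * P" "p * (gi * (1\<^sub>m N - P)) = 0\<^sub>m N N"
    "(1\<^sub>m N - P) * (f * p) = 0\<^sub>m N N" "P * (g * (1\<^sub>m N - p)) = 0\<^sub>m N N"
proof -
  note R = sq_mat_simps[where N=N]
  note [simp] = c
  have [simp]: "fi \<in> carrier_mat N N" "gi \<in> carrier_mat N N" by (simp_all add: fi_def gi_def R)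
  have mv: "Z *\<^sub>v v \<in> carrier_vec N" if "Z \<in> carrier_mat N N" "v \<in> carrier_vec N" for Z :: "complex mat" and v
    using that by (rule mult_mat_vec_carrier)
  have CC: "C * (C * Z) = Z" if "Z \<in> carrier_mat N N" for Z
    using C(1) that sq_mat_distrib(1)[of C N C Z] by (simp add: sq_mat_unit[where N=N])
  have frame': "g * C * f\<^sup>T = C"
    using arg_cong[OF frame, of transpose_mat] by (simp add: sq_mat_transpose_mult[where N=N] C R)
  have "f * fi = (f * C * g\<^sup>T) * C" by (simp add: fi_def R)
  then show ffi: "f * fi = 1\<^sub>m N" by (simp add: frame C)
  have "g * gi = (g * C * f\<^sup>T) * C" by (simp add: gi_def R)
  then show ggi: "g * gi = 1\<^sub>m N" by (simp add: frame' C)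
  show "fi * f = 1\<^sub>m N" by (rule mat_mult_left_right_inverse[OF _ _ ffi]) simp_all
  show "gi * g = 1\<^sub>m N" by (rule mat_mult_left_right_inverse[OF _ _ ggi]) simp_all
  show pfi: "p * (fi * P) = fi * P"
  proof (rule mat_eq_of_mult_vec[of _ N])
    fix v :: "complex vec" assume v: "v \<in> carrier_vec N"
    \<comment> \<open>As \<open>f u = P v\<close>, the vector \<open>u\<close> lies in the preimage
      of \<open>Im P\<close>, that is in the image of \<open>p\<close>, where \<open>p\<close> is
      the identity.\<close>
    define u where "u = fi *\<^sub>v (P *\<^sub>v v)"
    have "f *\<^sub>v u = (f * fi) *\<^sub>v (P *\<^sub>v v)" unfolding u_def
      by (rule assoc_mult_mat_vec[symmetric, of _ N N _ N]) (use v mv[OF c(4) v] in auto)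
    then have "f *\<^sub>v u = P *\<^sub>v v" using v unfolding ffi by (simp add: mv[OF c(4) v])
    then have "u \<in> preimage_space N f (mat_image N P)"
      unfolding preimage_space_def mat_image_def using v mv[OF _ mv[OF c(4) v], of fi] by (auto simp: u_def)
    then have "u \<in> mat_image N p" unfolding im .
    then obtain w where w: "w \<in> carrier_vec N" "u = p *\<^sub>v w" unfolding mat_image_def by blast
    have "p *\<^sub>v u = (p * p) *\<^sub>v w" unfolding w(2)
      by (rule assoc_mult_mat_vec[symmetric, of _ N N _ N]) (use w in auto)
    then have pu: "p *\<^sub>v u = u" using p w by simp
    have "(fi * P) *\<^sub>v v = u" unfolding u_def by (rule assoc_mult_mat_vec[of _ N N _ N]) (use v in auto)
    moreover have "(p * (fi * P)) *\<^sub>v v = p *\<^sub>v ((fi * P) *\<^sub>v v)"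
      by (rule assoc_mult_mat_vec[of _ N N _ N]) (use v in \<open>auto simp: sq_mat_closed\<close>)
    ultimately show "(p * (fi * P)) *\<^sub>v v = (fi * P) *\<^sub>v v" using pu by simp
  qed (simp_all add: R)
  have "P * (f * p) = f * p"
  proof (rule mat_eq_of_mult_vec[of _ N])
    fix v :: "complex vec" assume v: "v \<in> carrier_vec N"
    have "p *\<^sub>v v \<in> mat_image N p" unfolding mat_image_def using v by blast
    then have "p *\<^sub>v v \<in> preimage_space N f (mat_image N P)" unfolding im .
    then obtain w where w: "w \<in> carrier_vec N" "f *\<^sub>v (p *\<^sub>v v) = P *\<^sub>v w"
      unfolding preimage_space_def mat_image_def by blast
    have fp: "(f * p) *\<^sub>v v = P *\<^sub>v w"
      unfolding w(2)[symmetric] by (rule assoc_mult_mat_vec[of _ N N _ N]) (use v in auto)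
    have "(P * (f * p)) *\<^sub>v v = P *\<^sub>v ((f * p) *\<^sub>v v)"
      by (rule assoc_mult_mat_vec[of _ N N _ N]) (use v in \<open>auto simp: sq_mat_closed\<close>)
    also have "\<dots> = (P * P) *\<^sub>v w" unfolding fp
      by (rule assoc_mult_mat_vec[symmetric, of _ N N _ N]) (use w in auto)
    finally show "(P * (f * p)) *\<^sub>v v = (f * p) *\<^sub>v v" using P fp by simp
  qed (simp_all add: R)
  then show Pfp: "(1\<^sub>m N - P) * (f * p) = 0\<^sub>m N N" by (simp add: R)
  have tr: "C * (1\<^sub>m N - Z) = (1\<^sub>m N - Z)\<^sup>T * C" if "Z \<in> carrier_mat N N" "C * Z = Z\<^sup>T * C" for Z
    using that by (simp add: sq_mat_transpose_minus[of _ N] R)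
  have left: "Z = 0\<^sub>m N N" if "C * Z = 0\<^sub>m N N" "Z \<in> carrier_mat N N" for Z
    using CC[OF that(2)] that(1) by (simp add: sq_mat_unit[where N=N])
  \<comment> \<open>The remaining two equations are adjoint, with respect to \<open>C\<close>, to those just proved.\<close>
  define Q Qp where "Q = 1\<^sub>m N - P" and "Qp = 1\<^sub>m N - p"
  have [simp]: "Q \<in> carrier_mat N N" "Qp \<in> carrier_mat N N" by (simp_all add: Q_def Qp_def R)
  have "C * (p * (gi * Q)) = p\<^sup>T * (C * (C * (f\<^sup>T * (C * Q))))"
    using arg_cong[OF p(2), of "\<lambda>Z. Z * (gi * Q)"] by (simp add: gi_def R)
  also have "\<dots> = p\<^sup>T * (f\<^sup>T * (Q\<^sup>T * C))"
    using tr[OF c(4) P(2)] by (simp add: CC R Q_def[symmetric])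
  also have "\<dots> = (Q * (f * p))\<^sup>T * C"
    by (simp add: sq_mat_transpose_mult[where N=N] R)
  also have "\<dots> = 0\<^sub>m N N" using Pfp by (simp add: Q_def R)
  finally show "p * (gi * (1\<^sub>m N - P)) = 0\<^sub>m N N"
    unfolding Q_def[symmetric] by (rule left) (simp add: R)
  \<comment> \<open>Writing \<open>g\<close> through \<open>fi\<close> makes the claim the adjoint
    of \<open>(1 - p) fi P = 0\<close>.\<close>
  have g: "g = C * fi\<^sup>T * C"
    by (simp add: fi_def sq_mat_transpose_mult[where N=N] C R CC)
  have "C * (P * (g * Qp)) = P\<^sup>T * (C * (C * (fi\<^sup>T * (C * Qp))))"
    using arg_cong[OF P(2), of "\<lambda>Z. Z * (g * Qp)"] by (subst (asm) (2) g) (simp add: R)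
  also have "\<dots> = P\<^sup>T * (fi\<^sup>T * (Qp\<^sup>T * C))"
    using tr[OF c(3) p(2)] by (simp add: CC R Qp_def[symmetric])
  also have "\<dots> = (Qp * (fi * P))\<^sup>T * C"
    by (simp add: sq_mat_transpose_mult[where N=N] R)
  also have "Qp * (fi * P) = 0\<^sub>m N N" using pfi by (simp add: Qp_def R)
  finally have "C * (P * (g * Qp)) = 0\<^sub>m N N" by (simp add: R)
  then show "P * (g * (1\<^sub>m N - p)) = 0\<^sub>m N N"
    unfolding Qp_def[symmetric] by (rule left) (simp add: R)
qed

text \<open>The explicit inverses are linear in the entries of \<open>g\<close> and
  \<open>f\<close>, which supplies the derivatives of \<open>fi\<close> and \<open>gi\<close> that
  \<open>projection_deriv\<close> asks for.\<close>

lemma frame_projection_deriv: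
  fixes f g p :: "real \<Rightarrow> complex mat" and P C A B :: "complex mat"
  assumes cf: "\<And>s. f s \<in> carrier_mat N N" and cg: "\<And>s. g s \<in> carrier_mat N N"
    and cp: "\<And>s. p s \<in> carrier_mat N N" and c: "P \<in> carrier_mat N N" "C \<in> carrier_mat N N" "A \<in> carrier_mat N N" "B \<in> carrier_mat N N"
    and C: "C * C = 1\<^sub>m N" "C\<^sup>T = C" and frame: "\<And>s. f s * C * (g s)\<^sup>T = C"
    and P: "P * P = P" "C * P = P\<^sup>T * C" and p: "\<And>s. p s * p s = p s" "\<And>s. C * p s = (p s)\<^sup>T * C"
    and im: "\<And>s. mat_image N (p s) = preimage_space N (f s) (mat_image N P)"
    and df: "mat_deriv f (f x * A) x" and dg: "mat_deriv g (g x * B) x"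
  shows "mat_deriv p (p x * B * (1\<^sub>m N - p x) - (1\<^sub>m N - p x) * A * p x) x"
proof -
  note R = sq_mat_simps[where N=N]
  note [simp] = cf cg cp c
  note fp = frame_projection[OF cf cg cp c(1,2) C frame P p im]
  have conj: "mat_deriv (\<lambda>s. C * (h s)\<^sup>T * C) (C * D\<^sup>T * C) x"
    if "\<And>s. h s \<in> carrier_mat N N" "D \<in> carrier_mat N N" "mat_deriv h D x" for h D
    by (intro mat_deriv_mult_const[where N=N] mat_deriv_transpose[where N=N]) (use that in \<open>simp_all add: R\<close>)
  show ?thesis
    by (rule projection_deriv[where N=N and f=f and g=g and P=P and fi="\<lambda>s. C * (g s)\<^sup>T * C" and gi="\<lambda>s. C * (f s)\<^sup>T * C",
          OF cf cg _ _ cp c(1,3,4) fp(1-4) P(1) fp(5-8) df dg conj[OF cg _ dg] conj[OF cf _ df]])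
      (simp_all add: R)
qed

section \<open>The matrix C and the evolution of the projection\<close>

lemma Cmat_transpose: "(Cmat m n)\<^sup>T = Cmat m n"
proof (rule sq_mat_eqI[of _ "dimN m n"])
  fix r c assume rc: "r < dimN m n" "c < dimN m n"
  \<comment> \<open>Mirror positions in the odd block have indices summing to the even number
    \<open>2n\<close>, hence equal signs.\<close>
  have "(- 1 :: complex) ^ (n + (c - 2 * m)) = (- 1) ^ (n + (r - 2 * m))" if "r - 2 * m + (c - 2 * m) = 2 * n"
  proof -
    have "even (r - 2 * m + (c - 2 * m))" using that by simp
    then show ?thesis by (simp add: minus_one_power_iff)
  qed
  then show "(Cmat m n)\<^sup>T $$ (r,c) = Cmat m n $$ (r,c)"
    using rc by (auto simp: Cmat_def add.commute)
qed (simp_all add: Cmat_def)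

lemma Cmat_involution: "Cmat m n * Cmat m n = 1\<^sub>m (dimN m n)"
proof (rule sq_mat_eqI[of _ "dimN m n"])
  define N where "N = dimN m n"
  fix r c assume rc: "r < dimN m n" "c < dimN m n"
  \<comment> \<open>\<open>r'\<close> is the column of the only nonzero entry in row
    \<open>r\<close>, and \<open>z\<close> is that entry.\<close>
  define r' where "r' = (if r < 2 * m then 2 * m - 1 - r else 4 * m + 2 * n - r)"
  define z :: complex where "z = (if r < 2 * m then 1 else (- 1) ^ (n + (r - 2 * m)))"
  have r': "r' < N" using rc by (auto simp: r'_def N_def dimN_def)
  have row: "Cmat m n $$ (r,s) = (if s = r' then z else 0)" if "s < N" for s
    using that rc by (auto simp: Cmat_def N_def dimN_def r'_def z_def)
  have "(Cmat m n * Cmat m n) $$ (r,c) = (\<Sum>s<N. Cmat m n $$ (r,s) * Cmat m n $$ (s,c))"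
    unfolding N_def by (rule sq_mat_mult_index) (use rc in simp_all)
  also have "\<dots> = (\<Sum>s<N. if s = r' then z * Cmat m n $$ (r',c) else 0)"
    by (intro sum.cong refl) (simp add: row)
  also have "\<dots> = z * Cmat m n $$ (r',c)" using r' by simp
  also have "\<dots> = z * Cmat m n $$ (c,r')"
    using arg_cong[OF Cmat_transpose[of m n], of "\<lambda>Z. Z $$ (c,r')"] rc r' by (simp add: N_def carrier_matD[OF Cmat_carrier])
  also have "\<dots> = (if c = r then 1 else 0)"
  proof (cases "r < 2 * m")
    case True
    then show ?thesis using rc by (auto simp: Cmat_def dimN_def r'_def z_def)
  next
    case False
    have "z * z = 1" by (simp add: z_def power_mult_distrib[symmetric])
    then show ?thesis using False rc by (auto simp: Cmat_def dimN_def r'_def z_def)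
  qed
  finally show "(Cmat m n * Cmat m n) $$ (r,c) = 1\<^sub>m (dimN m n) $$ (r,c)" using rc by auto
qed (simp_all add: sq_mat_closed)

theorem mainTheorem6:
  fixes m n j :: nat and \<alpha> :: complex and \<pi> :: "complex mat"
    and q :: "real \<Rightarrow> real \<Rightarrow> complex mat"
    and S St :: "real \<Rightarrow> real \<Rightarrow> mser"
    and F :: "real \<Rightarrow> real \<Rightarrow> complex \<Rightarrow> complex mat"
    and \<pi>t :: "real \<Rightarrow> real \<Rightarrow> complex mat"
  assumes j: "1 \<le> j"
    and \<alpha>: "\<alpha> \<noteq> 0"
    and S: "is_S m n q S"
    and flow: "flow_sol m n j q S"
    and frame: "is_frame m n j q S F"
    and \<pi>: "Oproj m n \<pi>"
    and \<pi>t: "\<And>x t. Oproj m n (\<pi>t x t)"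
    and \<pi>t_im: "\<And>x t. mat_image (dimN m n) (\<pi>t x t)
                     = preimage_space (dimN m n) (F x t \<alpha>) (mat_image (dimN m n) \<pi>)"
    and nondeg: "\<And>x t. form_nondeg m n (preimage_space (dimN m n) (F x t \<alpha>) (mat_image (dimN m n) \<pi>))"
    and St: "is_S m n (\<lambda>x t. q x t + (2 * \<alpha>) \<cdot>\<^sub>m mcomm (Emat m n) (\<pi>t x t)) St"
  shows "\<forall>x t.
     mat_deriv (\<lambda>s. \<pi>t s t)
       ((Jat m n \<alpha> + q x t + (2 * \<alpha>) \<cdot>\<^sub>m mcomm (Emat m n) (\<pi>t x t)) * (1\<^sub>m (dimN m n) - \<pi>t x t)
        - (1\<^sub>m (dimN m n) - \<pi>t x t) * (Jat m n \<alpha> + q x t)) x \<and>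
     mat_deriv (\<lambda>s. \<pi>t x s)
       (ser_plus_eval (dimN m n) (ser_pow (dimN m n) (St x t) (2*j-1)) \<alpha> * (1\<^sub>m (dimN m n) - \<pi>t x t)
        - (1\<^sub>m (dimN m n) - \<pi>t x t) * ser_plus_eval (dimN m n) (ser_pow (dimN m n) (S x t) (2*j-1)) \<alpha>) t"
proof -
  define N where "N = dimN m n"
  note R = sq_mat_simps[where N=N]
  define E B C where "E = Emat m n" and "B = Bmat m n" and "C = Cmat m n"
  have [simp]: "E \<in> carrier_mat N N" "B \<in> carrier_mat N N" "C \<in> carrier_mat N N"
    by (simp_all add: E_def B_def C_def N_def)
  have cq[simp]: "q x t \<in> carrier_mat N N" and nq: "nonpos_weight m n (q x t)" for x t
    using flow nonpos_weight_Ymn unfolding flow_sol_def N_def by blast+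
  have cp[simp]: "\<pi>t x t \<in> carrier_mat N N" and pp: "\<pi>t x t * \<pi>t x t = \<pi>t x t"
    and pC: "C * \<pi>t x t = (\<pi>t x t)\<^sup>T * C" for x t
    using \<pi>t unfolding Oproj_def N_def C_def by blast+
  have cP: "\<pi> \<in> carrier_mat N N" and PP: "\<pi> * \<pi> = \<pi>" and PC: "C * \<pi> = \<pi>\<^sup>T * C"
    using \<pi> unfolding Oproj_def N_def C_def by blast+
  have ppX: "\<pi>t x t * (\<pi>t x t * X) = \<pi>t x t * X" if "X \<in> carrier_mat N N" for x t X
    using pp[of x t] that sq_mat_distrib(1)[of "\<pi>t x t" N "\<pi>t x t" X] by simp
  have J: "Jat m n l = l \<cdot>\<^sub>m E + B" for l by (simp add: Jat_def E_def B_def)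
  have cF: "F x t l \<in> carrier_mat N N"
    and Fx: "mat_deriv (\<lambda>s. F s t l) (F x t l * (Jat m n l + q x t)) x"
    and Ft: "mat_deriv (\<lambda>s. F x s l) (F x t l * ser_plus_eval N (ser_pow N (S x t) (2*j-1)) l) t"
    and FC: "F x t l * C * (F x t (- l))\<^sup>T = C" for x t l
    using frame unfolding is_frame_def N_def C_def by blast+
  note C2 = Cmat_involution[of m n, folded C_def N_def] and CT = Cmat_transpose[of m n, folded C_def]
  have dx: "mat_deriv (\<lambda>s. \<pi>t s t)
      ((Jat m n \<alpha> + q x t + (2 * \<alpha>) \<cdot>\<^sub>m mcomm (Emat m n) (\<pi>t x t)) * (1\<^sub>m N - \<pi>t x t)
        - (1\<^sub>m N - \<pi>t x t) * (Jat m n \<alpha> + q x t)) x" for x t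
  proof -
    have "mat_deriv (\<lambda>s. \<pi>t s t)
       (\<pi>t x t * (Jat m n (- \<alpha>) + q x t) * (1\<^sub>m N - \<pi>t x t)
        - (1\<^sub>m N - \<pi>t x t) * (Jat m n \<alpha> + q x t) * \<pi>t x t) x"
      by (rule frame_projection_deriv[where N=N and C=C and P=\<pi> and f="\<lambda>s. F s t \<alpha>" and g="\<lambda>s. F s t (- \<alpha>)",
            OF cF cF cp cP _ _ _ C2 CT FC PP PC pp pC \<pi>t_im[folded N_def] Fx Fx])
        (simp_all add: J R)
    \<comment> \<open>Since \<open>J(-\<alpha>) = J(\<alpha>) - 2 \<alpha> E\<close>, the two forms
      differ by the commutator term, for which
      \<open>[E, p] (1 - p) = - p E (1 - p)\<close>.\<close>
    also have "\<pi>t x t * (Jat m n (- \<alpha>) + q x t) * (1\<^sub>m N - \<pi>t x t)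
        - (1\<^sub>m N - \<pi>t x t) * (Jat m n \<alpha> + q x t) * \<pi>t x t
      = (Jat m n \<alpha> + q x t + (2 * \<alpha>) \<cdot>\<^sub>m mcomm (Emat m n) (\<pi>t x t)) * (1\<^sub>m N - \<pi>t x t)
        - (1\<^sub>m N - \<pi>t x t) * (Jat m n \<alpha> + q x t)"
      unfolding J mcomm_def E_def[symmetric]
      by (rule sq_mat_eqI[of _ N])
        (simp_all add: R pp ppX algebra_simps del: index_mult_mat index_add_mat index_minus_mat)
    finally show ?thesis .
  qed
  define qt where "qt x t = q x t + (2 * \<alpha>) \<cdot>\<^sub>m mcomm (Emat m n) (\<pi>t x t)" for x t
  have Jqt: "Jat m n \<alpha> + qt x t = Jat m n \<alpha> + q x t + (2 * \<alpha>) \<cdot>\<^sub>m mcomm (Emat m n) (\<pi>t x t)" for x t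
    unfolding qt_def J mcomm_def E_def[symmetric]
    by (rule assoc_add_mat[symmetric, of _ N N]) (simp_all add: R)
  have dt: "mat_deriv (\<lambda>s. \<pi>t x s)
       (ser_plus_eval N (ser_pow N (St x t) (2*j-1)) \<alpha> * (1\<^sub>m N - \<pi>t x t)
        - (1\<^sub>m N - \<pi>t x t) * ser_plus_eval N (ser_pow N (S x t) (2*j-1)) \<alpha>) t" for x t
  proof -
    have bS: "ser_bdd N (S x t)" and bT: "ser_bdd N (St x t)"
      using S St by (auto simp: is_S_def N_def)
    have "mat_deriv (\<lambda>s. \<pi>t x s)
       (\<pi>t x t * ser_plus_eval N (ser_pow N (S x t) (2*j-1)) (- \<alpha>) * (1\<^sub>m N - \<pi>t x t)
        - (1\<^sub>m N - \<pi>t x t) * ser_plus_eval N (ser_pow N (S x t) (2*j-1)) \<alpha> * \<pi>t x t) t"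
      by (rule frame_projection_deriv[where N=N and C=C and P=\<pi> and f="\<lambda>s. F x s \<alpha>" and g="\<lambda>s. F x s (- \<alpha>)",
            OF cF cF cp cP _ _ _ C2 CT FC PP PC pp pC \<pi>t_im[folded N_def] Ft Ft])
        simp_all
    also have "\<pi>t x t * ser_plus_eval N (ser_pow N (S x t) (2*j-1)) (- \<alpha>) * (1\<^sub>m N - \<pi>t x t)
        - (1\<^sub>m N - \<pi>t x t) * ser_plus_eval N (ser_pow N (S x t) (2*j-1)) \<alpha> * \<pi>t x t
      = ser_plus_eval N (ser_pow N (St x t) (2*j-1)) \<alpha> * (1\<^sub>m N - \<pi>t x t)
        - (1\<^sub>m N - \<pi>t x t) * ser_plus_eval N (ser_pow N (S x t) (2*j-1)) \<alpha>"
    proof (rule ser_plus_eval_darboux[symmetric, OF _ _ _ _ cp pp \<alpha>])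
      fix i
      \<comment> \<open>The equation in the t-direction rests on the one in the x-direction:
        \<open>dx\<close> provides the derivative of \<open>p\<close> that
        \<open>darboux_intertwining\<close> requires.\<close>
      show "ser_pow N (St x t) (2*j-1) (i - 1) + ser_pow N (St x t) (2*j-1) i * (\<alpha> \<cdot>\<^sub>m 1\<^sub>m N - (2 * \<alpha>) \<cdot>\<^sub>m \<pi>t x t)
        = ser_pow N (S x t) (2*j-1) (i - 1) + (\<alpha> \<cdot>\<^sub>m 1\<^sub>m N - (2 * \<alpha>) \<cdot>\<^sub>m \<pi>t x t) * ser_pow N (S x t) (2*j-1) i"
        unfolding N_def
        by (rule darboux_intertwining[where q=q]) 
          (use S St cq nq cp pp dx Jqt[unfolded qt_def] in \<open>simp_all add: N_def[symmetric]\<close>)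
    qed (simp_all add: ser_bdd_pow bS bT)
    finally show ?thesis .
  qed
  show ?thesis using dx dt unfolding N_def by blast
qed

end
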